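(* Assume the Proper Forcing Axiom (PFA). Then every finite product of separable metric $\gamma$-spaces satisfies $\mathsf S_{\mathrm{fin}}(\Omega,\Omega)$.
   Context: A cover of $X$ is a family $\mathcal U$ with $X=\bigcup\mathcal U$ such that $X$ is not contained in a single member. $\Omega(X)$ is the family of open $\omega$-covers (every finite subset of $X$ lies in some member); an open cover is a $\gamma$-cover if it is infinite and every point lies in all but finitely many members. $X$ is a $\gamma$-space if every open $\omega$-cover contains a $\gamma$-cover. $\mathsf S_{\mathrm{fin}}(\Omega,\Omega)$: for every sequence $(\mathcal U_n)$ in $\Omega(X)$ there are finite $\mathcal F_n\subseteq\mathcal U_n$ with $\bigcup_n\mathcal F_n\in\Omega(X)$. *)

theory Defs
  imports "HOL-Analysis.Analysis"
begin

unbundle cardinal_syntax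

section \<open>Covers and selection principles\<close>

definition cover_of :: "'a topology \<Rightarrow> 'a set set \<Rightarrow> bool" where
  "cover_of X \<U> \<longleftrightarrow> \<Union>\<U> = topspace X \<and> (\<forall>U\<in>\<U>. \<not> topspace X \<subseteq> U)"

definition open_cover_of :: "'a topology \<Rightarrow> 'a set set \<Rightarrow> bool" where
  "open_cover_of X \<U> \<longleftrightarrow> cover_of X \<U> \<and> (\<forall>U\<in>\<U>. openin X U)"

definition Omega_covers :: "'a topology \<Rightarrow> 'a set set set" where
  "Omega_covers X = {\<U>. open_cover_of X \<U> \<and>
     (\<forall>F. finite F \<and> F \<subseteq> topspace X \<longrightarrow> (\<exists>U\<in>\<U>. F \<subseteq> U))}"

definition Gamma_covers :: "'a topology \<Rightarrow> 'a set set set" where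
  "Gamma_covers X = {\<U>. open_cover_of X \<U> \<and> infinite \<U> \<and>
     (\<forall>x\<in>topspace X. finite {U\<in>\<U>. x \<notin> U})}"

definition gamma_space :: "'a topology \<Rightarrow> bool" where
  "gamma_space X \<longleftrightarrow> (\<forall>\<U>\<in>Omega_covers X. \<exists>\<V>\<in>Gamma_covers X. \<V> \<subseteq> \<U>)"

definition S_fin_Omega_Omega :: "'a topology \<Rightarrow> bool" where
  "S_fin_Omega_Omega X \<longleftrightarrow>
     (\<forall>\<U> :: nat \<Rightarrow> 'a set set. (\<forall>n. \<U> n \<in> Omega_covers X) \<longrightarrow>
        (\<exists>\<F>. (\<forall>n. finite (\<F> n) \<and> \<F> n \<subseteq> \<U> n) \<and> (\<Union>n. \<F> n) \<in> Omega_covers X))"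


section \<open>Proper forcing\<close>

text \<open>
  Forcing notions are nonempty preorders, given by a carrier \<open>P\<close> and a relation \<open>r\<close>;
  \<open>(p, q) \<in> r\<close> means \<open>p \<le> q\<close>, that is, \<open>p\<close> is the stronger condition.
\<close>

definition forcing_notion :: "'p set \<Rightarrow> 'p rel \<Rightarrow> bool" where
  "forcing_notion P r \<longleftrightarrow> P \<noteq> {} \<and> preorder_on P r"

definition forcing_compatible :: "'p set \<Rightarrow> 'p rel \<Rightarrow> 'p \<Rightarrow> 'p \<Rightarrow> bool" where
  "forcing_compatible P r p q \<longleftrightarrow> (\<exists>s\<in>P. (s, p) \<in> r \<and> (s, q) \<in> r)"

definition forcing_dense :: "'p set \<Rightarrow> 'p rel \<Rightarrow> 'p set \<Rightarrow> bool" where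
  "forcing_dense P r D \<longleftrightarrow> D \<subseteq> P \<and> (\<forall>p\<in>P. \<exists>q\<in>D. (q, p) \<in> r)"

definition predense_below :: "'p set \<Rightarrow> 'p rel \<Rightarrow> 'p set \<Rightarrow> 'p \<Rightarrow> bool" where
  "predense_below P r E q \<longleftrightarrow> (\<forall>s\<in>P. (s, q) \<in> r \<longrightarrow> (\<exists>e\<in>E. forcing_compatible P r s e))"

definition forcing_filter :: "'p set \<Rightarrow> 'p rel \<Rightarrow> 'p set \<Rightarrow> bool" where
  "forcing_filter P r G \<longleftrightarrow> G \<subseteq> P \<and> G \<noteq> {} \<and>
     (\<forall>p\<in>G. \<forall>q\<in>P. (p, q) \<in> r \<longrightarrow> q \<in> G) \<and>
     (\<forall>p\<in>G. \<forall>q\<in>G. \<exists>s\<in>G. (s, p) \<in> r \<and> (s, q) \<in> r)"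

text \<open>Closed unbounded families of countable subsets of \<open>W\<close>.\<close>

definition club_countable :: "'w set \<Rightarrow> 'w set set \<Rightarrow> bool" where
  "club_countable W C \<longleftrightarrow>
     (\<forall>M\<in>C. countable M \<and> M \<subseteq> W) \<and>
     (\<forall>A. countable A \<and> A \<subseteq> W \<longrightarrow> (\<exists>M\<in>C. A \<subseteq> M)) \<and>
     (\<forall>M :: nat \<Rightarrow> 'w set. (\<forall>n. M n \<in> C \<and> M n \<subseteq> M (Suc n)) \<longrightarrow> (\<Union>n. M n) \<in> C)"

text \<open>
  \<open>P\<close> is proper if for club many countable \<open>M \<prec> H(\<theta>)\<close> every condition in \<open>M\<close> has an
  \<open>(M, P)\<close>-generic extension.  Genericity of \<open>q\<close> over \<open>M\<close> depends only on which conditions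
  and which sets of conditions belong to \<open>M\<close>.  So \<open>M\<close> is represented here by its trace
  on \<open>P \<union> Pow P\<close>, coded as a disjoint sum because the two parts have different types.
  Clubs of countable subsets project and lift between \<open>H(\<theta>)\<close> and \<open>P \<union> Pow P\<close>, so no
  \<open>H(\<theta>)\<close> is needed.
\<close>

definition master_condition ::
    "'p set \<Rightarrow> 'p rel \<Rightarrow> ('p + 'p set) set \<Rightarrow> 'p \<Rightarrow> bool" where
  "master_condition P r M q \<longleftrightarrow> q \<in> P \<and>
     (\<forall>D. forcing_dense P r D \<and> Inr D \<in> M \<longrightarrow> predense_below P r {p\<in>D. Inl p \<in> M} q)"

definition proper_forcing :: "'p set \<Rightarrow> 'p rel \<Rightarrow> bool" where
  "proper_forcing P r \<longleftrightarrow> forcing_notion P r \<and>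
     (\<exists>C. club_countable (Inl ` P \<union> Inr ` Pow P) C \<and>
        (\<forall>M\<in>C. \<forall>p. Inl p \<in> M \<longrightarrow> (\<exists>q. (q, p) \<in> r \<and> master_condition P r M q)))"

text \<open>
  The Proper Forcing Axiom for forcing notions whose conditions are taken from the type \<open>'p\<close>.
  HOL cannot quantify over all types, so the class of all forcing notions has to be cut down
  to a type.  Since properness and the conclusion are invariant under isomorphism, this is
  the axiom for all proper forcing notions of cardinality at most that of \<open>'p\<close>; in
  particular it follows from the full axiom, whichever type is chosen.
  \<open>cardSuc natLeq\<close> is the cardinal \<open>\<aleph>\<^sub>1\<close>.
\<close>

definition PFA :: "'p itself \<Rightarrow> bool" where
  "PFA _ \<longleftrightarrow>
     (\<forall>(P :: 'p set) r. proper_forcing P r \<longrightarrow>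
        (\<forall>\<D>. (\<forall>D\<in>\<D>. forcing_dense P r D) \<and> |\<D>| \<le>o cardSuc natLeq \<longrightarrow>
           (\<exists>G. forcing_filter P r G \<and> (\<forall>D\<in>\<D>. G \<inter> D \<noteq> {}))))"

end

theory Submission
  imports Defs "HOL-Library.Ramsey"
begin

text \<open>
  By the usual coding, it suffices that finite products of separable metric \<open>\<gamma>\<close>-spaces have a
  Menger type property: if for every \<open>j\<close> the increasing open sets \<open>V j e\<close> cover the product, then
  for some \<open>h\<close> the sets \<open>V j (h j)\<close> cover it (applied to all finite powers of the product).
  Suppose that each \<open>h\<close> misses a point \<open>X h\<close>.
  Consider the sequences of pairs (basic box, number \<open>e\<close>) such that every point of each factor
  lies in almost all boxes and the \<open>j\<close>-th box is not covered by \<open>V j e\<close>.  Join two sequences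
  if for some \<open>j\<close> the intersection of the \<open>j\<close>-th boxes is covered by the larger of the two sets
  \<open>V j e\<close>.  This is an open graph.  PFA implies the Open Colouring Axiom, which leaves two cases.
  An uncountable clique of size \<open>\<aleph>\<^sub>1\<close> is refuted by a bound \<open>h\<close> for the numbers \<open>e\<close> (PFA for Hechler
  forcing) and the point \<open>X h\<close>.  If the sequences are a countable union of edgeless sets, a
  finite game on the product is won, by Ramsey's theorem, by the player who avoids a given
  edgeless set at a given index; the \<open>\<gamma>\<close>-property of the factors strings winning moves together
  to a sequence in none of the edgeless sets.
\<close>

section \<open>Properness and the transfer of PFA along injections\<close>

text \<open>The familiar route to open colouring first forces the continuum down to
  \<aleph>\<open>\<^sub>1\<close> by a \<sigma>-closed forcing, so that the closed sets of tuples
  can be listed and diagonalised against, and only then adds cliques by finite conditions. Here one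
  forcing does both: its countable pools hold the free sets that matter to one countable model.
  Since a pool contains functions from lists of points to sets of points, conditions are large, and
  this is where the type \<open>real set set set set\<close> comes from. The game is played one
  coordinate at a time because the \<gamma>-property is available for single factors only; the
  selection in each factor thins out the index set left by the preceding factors. Two plays against
  one strategy are compared because an edge needs two sequences. The number \<open>e\<close> may be
  chosen after both plays: the player avoiding an edgeless set at some index needs only one number
  that never occurs there together with the boxes played, so a loss makes every number available for
  both plays.\<close>

lemma PFA_transfer:
  fixes f :: "'q \<Rightarrow> 'p"
  assumes pfa: "PFA TYPE('p)" and f: "inj f"
  shows "PFA TYPE('q)"
  unfolding PFA_def
proof (intro allI impI, elim conjE)
  fix P :: "'q set" and r \<D>
  assume proper: "proper_forcing P r" and dense: "\<forall>D\<in>\<D>. forcing_dense P r D"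
    and card: "|\<D>| \<le>o cardSuc natLeq"
  let ?r = "map_prod f f ` r"
  have rel [simp]: "(f a, f b) \<in> ?r \<longleftrightarrow> (a, b) \<in> r" for a b
    using inj_image_mem_iff[OF prod.inj_map[OF f f], of "(a, b)"] by simp
  have pre: "P \<noteq> {}" "preorder_on P r"
    using proper by (auto simp: proper_forcing_def forcing_notion_def)
  have sub: "r \<subseteq> P \<times> P"
    using pre by (auto simp: preorder_on_def)
  have pre': "preorder_on (f ` P) ?r"
  proof -
    have "trans ?r"
    proof (rule transI)
      fix x y z assume xy: "(x, y) \<in> ?r" and yz: "(y, z) \<in> ?r"
      obtain a b where "x = f a" "y = f b" "(a, b) \<in> r" using xy by auto
      moreover obtain c e where "y = f c" "z = f e" "(c, e) \<in> r" using yz by auto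
      ultimately show "(x, z) \<in> ?r"
        using pre(2) injD[OF f, of b c] by (auto simp: preorder_on_def dest: transD)
    qed
    moreover have "refl_on (f ` P) ?r" using pre(2) by (auto simp: preorder_on_def refl_on_def)
    moreover have "?r \<subseteq> f ` P \<times> f ` P" using sub by auto
    ultimately show ?thesis by (simp add: preorder_on_def)
  qed
  have compat: "forcing_compatible (f ` P) ?r (f p) (f q) \<longleftrightarrow> forcing_compatible P r p q" for p q
    by (auto simp: forcing_compatible_def)
  have dense': "forcing_dense (f ` P) ?r (f ` D) \<longleftrightarrow> forcing_dense P r D" for D
    using f by (auto simp: forcing_dense_def inj_image_subset_iff)
  \<comment> \<open>Traces of models contain conditions and sets of conditions, so \<open>f\<close>
    acts on the second summand by images. The club is carried along \<open>F\<close>.\<close>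
  define F where "F = map_sum f (image f)"
  have injF: "inj F"
    unfolding F_def using f by (intro sum.inj_map) (auto simp: inj_image_eq_iff intro!: injI)
  have F [simp]: "F (Inl p) = Inl (f p)" "F (Inr D) = Inr (f ` D)" for p D
    by (auto simp: F_def)
  have Fimg: "Inl (f p) \<in> F ` M \<longleftrightarrow> Inl p \<in> M" "Inr (f ` D) \<in> F ` M \<longleftrightarrow> Inr D \<in> M" for p D M
    using injF F by (metis inj_image_mem_iff)+
  have W: "Inl ` f ` P \<union> Inr ` Pow (f ` P) = F ` (Inl ` P \<union> Inr ` Pow P)"
    by (auto simp: image_Un image_image) (metis (no_types, lifting) PowI image_eqI subset_imageE F(2))
  obtain C where club: "club_countable (Inl ` P \<union> Inr ` Pow P) C"
    and gen: "\<And>M p. M \<in> C \<Longrightarrow> Inl p \<in> M \<Longrightarrow> \<exists>q. (q, p) \<in> r \<and> master_condition P r M q"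
    using proper unfolding proper_forcing_def by blast
  let ?W = "Inl ` P \<union> Inr ` Pow P"
  have C1: "countable M" "M \<subseteq> ?W" if "M \<in> C" for M
    using club that unfolding club_countable_def by simp_all
  have C2: "\<exists>M\<in>C. A \<subseteq> M" if "countable A" "A \<subseteq> ?W" for A
    using club that unfolding club_countable_def by simp
  have C3: "(\<Union>n. M n) \<in> C" if "\<And>n. M n \<in> C \<and> M n \<subseteq> M (Suc n)" for M :: "nat \<Rightarrow> _"
    using club that unfolding club_countable_def by simp
  have club': "club_countable (Inl ` f ` P \<union> Inr ` Pow (f ` P)) ((`) F ` C)"
    unfolding W club_countable_def
  proof (intro conjI ballI allI impI)
    fix M assume "M \<in> (`) F ` C"
    then obtain N where "N \<in> C" "M = F ` N" by (rule imageE)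
    then show "countable M" "M \<subseteq> F ` ?W"
      using C1[of N] by (simp_all add: image_mono)
  next
    fix A assume A: "countable A \<and> A \<subseteq> F ` ?W"
    then obtain B where B: "B \<subseteq> ?W" "A = F ` B"
      unfolding subset_image_iff by blast
    have "countable B"
      using A countable_image_inj_on[of F B] inj_on_subset[OF injF, of B] B(2) by simp
    then obtain M where "M \<in> C" "B \<subseteq> M" using C2[OF _ B(1)] by blast
    then show "\<exists>M\<in>(`) F ` C. A \<subseteq> M" unfolding B(2) by (intro bexI[of _ "F ` M"] image_mono imageI)
  next
    fix M :: "nat \<Rightarrow> _" assume M: "\<forall>n. M n \<in> (`) F ` C \<and> M n \<subseteq> M (Suc n)"
    then have "\<forall>n. \<exists>N. N \<in> C \<and> M n = F ` N" by (simp add: image_iff Bex_def)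
    then obtain N where N: "\<And>n. N n \<in> C" "\<And>n. M n = F ` N n" by metis
    then have "N n \<subseteq> N (Suc n)" for n
      using M inj_image_subset_iff[OF injF] by simp
    then have "(\<Union>n. N n) \<in> C" using C3 N(1) by blast
    then show "(\<Union>n. M n) \<in> (`) F ` C" unfolding N(2) image_UN[symmetric] by (rule imageI)
  qed
  have "\<exists>q. (q, p) \<in> ?r \<and> master_condition (f ` P) ?r N q" if N: "N \<in> (`) F ` C" and pN: "Inl p \<in> N" for N p
  proof -
    obtain M where M: "M \<in> C" "N = F ` M" using N by (rule imageE)
    obtain p' where p': "Inl p' \<in> M" "p = f p'"
      using pN unfolding M(2) by (auto simp: F_def map_sum_def split: sum.splits)
    obtain q where q: "(q, p') \<in> r" "master_condition P r M q"
      using gen[OF M(1) p'(1)] by blast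
    have "master_condition (f ` P) ?r N (f q)"
      unfolding master_condition_def
    proof (intro conjI allI impI, goal_cases)
      case 1 then show ?case using q(2) by (auto simp: master_condition_def)
    next
      case (2 E)
      then obtain D where D: "E = f ` D" "D \<subseteq> P"
        unfolding forcing_dense_def subset_image_iff by blast
      have "predense_below P r {p \<in> D. Inl p \<in> M} q"
        using 2 q(2) dense'[of D] Fimg(2)[of D M] unfolding master_condition_def M(2) D(1) by simp
      then have *: "\<exists>p\<in>D. Inl p \<in> M \<and> forcing_compatible P r s p" if "s \<in> P" "(s, q) \<in> r" for s
        using that unfolding predense_below_def by blast
      have "\<exists>e\<in>{p \<in> E. Inl p \<in> N}. forcing_compatible (f ` P) ?r (f s) e"
        if s: "s \<in> P" "(s, q) \<in> r" for s
      proof -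
        obtain p where "p \<in> D" "Inl p \<in> M" "forcing_compatible P r s p" using *[OF s] by blast
        then show ?thesis
          unfolding D(1) M(2) by (intro bexI[of _ "f p"]) (simp_all only: compat mem_Collect_eq Fimg imageI simp_thms)
      qed
      then show ?case
        unfolding predense_below_def using rel by (metis (no_types, lifting) imageE)
    qed
    then show ?thesis using q(1) p'(2) by auto
  qed
  then have "proper_forcing (f ` P) ?r"
    using club' pre pre' unfolding proper_forcing_def forcing_notion_def by blast
  moreover have "|(`) f ` \<D>| \<le>o cardSuc natLeq"
    using card card_of_image ordLeq_transitive by blast
  ultimately obtain G where G: "forcing_filter (f ` P) ?r G" "\<forall>D\<in>\<D>. G \<inter> f ` D \<noteq> {}"
    using pfa[unfolded PFA_def, rule_format, of "f ` P" ?r "(`) f ` \<D>"] dense dense' by (simp add: Ball_def image_iff) metis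
  then obtain G' where G': "G = f ` G'" "G' \<subseteq> P"
    unfolding forcing_filter_def subset_image_iff by blast
  have "forcing_filter P r G'"
    unfolding forcing_filter_def
  proof (intro conjI ballI impI)
    show "G' \<subseteq> P" "G' \<noteq> {}" using G(1) G' by (auto simp: forcing_filter_def)
    fix p assume p: "p \<in> G'"
    show "q \<in> G'" if "q \<in> P" "(p, q) \<in> r" for q
    proof -
      have "f q \<in> G" using G(1) p that unfolding forcing_filter_def G'(1) by (meson imageI rel)
      then show ?thesis unfolding G'(1) by (simp add: inj_image_mem_iff[OF f])
    qed
    show "\<exists>s\<in>G'. (s, p) \<in> r \<and> (s, q) \<in> r" if "q \<in> G'" for q
    proof -
      have "\<exists>s\<in>G. (s, f p) \<in> ?r \<and> (s, f q) \<in> ?r"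
        using G(1) p that unfolding forcing_filter_def G'(1) by blast
      then show ?thesis unfolding G'(1) bex_simps rel by simp
    qed
  qed
  moreover have "\<forall>D\<in>\<D>. G' \<inter> D \<noteq> {}"
    using G(2) unfolding G'(1) by (simp add: image_Int[OF f, symmetric])
  ultimately show "\<exists>G. forcing_filter P r G \<and> (\<forall>D\<in>\<D>. G \<inter> D \<noteq> {})" by blast
qed

section \<open>Clubs of closed sets, and properness from countable predense subsets\<close>

lemma club_countable_closed:
  assumes M0: "countable M0" "M0 \<subseteq> W"
    and g: "\<And>a b. a \<in> W \<Longrightarrow> b \<in> W \<Longrightarrow> countable (g a b) \<and> g a b \<subseteq> W"
  shows "club_countable W {M. countable M \<and> M \<subseteq> W \<and> M0 \<subseteq> M \<and> (\<forall>a\<in>M. \<forall>b\<in>M. g a b \<subseteq> M)}"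
  unfolding club_countable_def
proof (intro conjI allI impI)
  fix A assume A: "countable A \<and> A \<subseteq> W"
  define S where "S = rec_nat (A \<union> M0) (\<lambda>_ X. X \<union> (\<Union>a\<in>X. \<Union>b\<in>X. g a b))"
  have S0: "S 0 = A \<union> M0" and SS: "S (Suc n) = S n \<union> (\<Union>a\<in>S n. \<Union>b\<in>S n. g a b)" for n
    by (auto simp: S_def)
  have S: "countable (S n) \<and> S n \<subseteq> W" for n
  proof (induction n)
    case (Suc n)
    then show ?case using g unfolding SS by (auto intro!: countable_UN)
  qed (use A M0 S0 in auto)
  have mono: "m \<le> n \<Longrightarrow> S m \<subseteq> S n" for m n
    by (rule lift_Suc_mono_le[of S]) (auto simp: SS)
  have "g a b \<subseteq> (\<Union>n. S n)" if "a \<in> S m" "b \<in> S n" for a b m n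
  proof -
    have "a \<in> S (max m n)" "b \<in> S (max m n)" using that mono by (meson max.cobounded1 max.cobounded2 subsetD)+
    then have "g a b \<subseteq> S (Suc (max m n))" unfolding SS by blast
    then show ?thesis by blast
  qed
  then have "\<forall>a\<in>\<Union>n. S n. \<forall>b\<in>\<Union>n. S n. g a b \<subseteq> (\<Union>n. S n)" by (metis UN_E)
  moreover have "countable (\<Union>n. S n)" "(\<Union>n. S n) \<subseteq> W" "A \<union> M0 \<subseteq> (\<Union>n. S n)"
    using S S0 by auto
  ultimately show "\<exists>M\<in>{M. countable M \<and> M \<subseteq> W \<and> M0 \<subseteq> M \<and> (\<forall>a\<in>M. \<forall>b\<in>M. g a b \<subseteq> M)}. A \<subseteq> M"
    by (intro bexI[of _ "\<Union>n. S n"] CollectI conjI) auto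
next
  fix M :: "nat \<Rightarrow> _"
  assume M: "\<forall>n. M n \<in> {M. countable M \<and> M \<subseteq> W \<and> M0 \<subseteq> M \<and> (\<forall>a\<in>M. \<forall>b\<in>M. g a b \<subseteq> M)} \<and> M n \<subseteq> M (Suc n)"
  then have mono: "m \<le> n \<Longrightarrow> M m \<subseteq> M n" for m n
    using lift_Suc_mono_le[of M] by blast
  have "g a b \<subseteq> (\<Union>n. M n)" if "a \<in> M m" "b \<in> M n" for a b m n
  proof -
    have "a \<in> M (max m n)" "b \<in> M (max m n)" using that mono by (meson max.cobounded1 max.cobounded2 subsetD)+
    then have "g a b \<subseteq> M (max m n)" using M by blast
    then show ?thesis by blast
  qed
  then have "\<forall>a\<in>\<Union>n. M n. \<forall>b\<in>\<Union>n. M n. g a b \<subseteq> (\<Union>n. M n)" by (metis UN_E)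
  moreover have "countable (\<Union>n. M n)" "(\<Union>n. M n) \<subseteq> W" "M0 \<subseteq> (\<Union>n. M n)"
    using M by (auto, blast)
  ultimately show "(\<Union>n. M n) \<in> {M. countable M \<and> M \<subseteq> W \<and> M0 \<subseteq> M \<and> (\<forall>a\<in>M. \<forall>b\<in>M. g a b \<subseteq> M)}"
    by (intro CollectI conjI)
qed auto

text \<open>Each condition is its own master condition, because a model closed under choosing
  \<open>A D\<close> contains a countable predense part of every dense set in it. The countable
  chain condition provides such a part as a maximal antichain inside \<open>D\<close>.\<close>

lemma ccc_proper:
  fixes P :: "'a set"
  assumes P: "forcing_notion P r"
    and A: "\<And>D. forcing_dense P r D \<Longrightarrow> \<exists>A. countable A \<and> A \<subseteq> D \<and> (\<forall>s\<in>P. \<exists>a\<in>A. forcing_compatible P r s a)"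
  shows "proper_forcing P r"
proof -
  obtain A where A: "\<And>D. forcing_dense P r D \<Longrightarrow> countable (A D) \<and> A D \<subseteq> D \<and> (\<forall>s\<in>P. \<exists>a\<in>A D. forcing_compatible P r s a)"
    using A by metis
  let ?W = "Inl ` P \<union> Inr ` Pow P"
  define g :: "'a + 'a set \<Rightarrow> 'a + 'a set \<Rightarrow> ('a + 'a set) set" where
    "g a b = (case b of Inl p \<Rightarrow> {} | Inr D \<Rightarrow> if forcing_dense P r D then Inl ` A D else {})" for a b :: "'a + 'a set"
  have "club_countable ?W {M. countable M \<and> M \<subseteq> ?W \<and> {} \<subseteq> M \<and> (\<forall>a\<in>M. \<forall>b\<in>M. g a b \<subseteq> M)}"
    using A by (intro club_countable_closed) (auto simp: g_def forcing_dense_def split: sum.splits; blast)+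
  moreover have "\<exists>q. (q, p) \<in> r \<and> master_condition P r M q"
    if M: "M \<subseteq> ?W" "\<forall>a\<in>M. \<forall>b\<in>M. g a b \<subseteq> M" "Inl p \<in> M" for M p
  proof (intro exI conjI)
    have p: "p \<in> P" using M by auto
    then show "(p, p) \<in> r" using P by (auto simp: forcing_notion_def preorder_on_def refl_on_def)
    have "predense_below P r {p \<in> D. Inl p \<in> M} p" if D: "forcing_dense P r D" "Inr D \<in> M" for D
    proof -
      have "Inl ` A D \<subseteq> M" using M(2,3) D by (force simp: g_def)
      then show ?thesis using A[OF D(1)] unfolding predense_below_def by blast
    qed
    then show "master_condition P r M p" using p by (auto simp: master_condition_def)
  qed
  ultimately show ?thesis using P unfolding proper_forcing_def by (metis (no_types, lifting) mem_Collect_eq)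
qed

section \<open>Hechler forcing\<close>

definition hechler :: "(nat list \<times> (nat \<Rightarrow> nat)) rel" where
  "hechler = {((t', h'), (t, h)). (\<exists>u. t' = t @ u) \<and> h \<le> h' \<and> (\<forall>i. length t \<le> i \<and> i < length t' \<longrightarrow> h i \<le> t' ! i)}"

lemma hechler_preorder: "preorder_on UNIV hechler"
proof -
  have "trans hechler"
  proof (rule transI, clarify)
    fix t h t' h' t'' h''
    assume 1: "((t, h), (t', h')) \<in> hechler" and 2: "((t', h'), (t'', h'')) \<in> hechler"
    have "h'' i \<le> t ! i" if "length t'' \<le> i" "i < length t" for i
    proof (cases "i < length t'")
      case True
      then have "t ! i = t' ! i" using 1 by (auto simp: hechler_def nth_append)
      then show ?thesis using True 2 that by (auto simp: hechler_def)
    next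
      case False
      then have "h' i \<le> t ! i" using 1 that by (auto simp: hechler_def)
      then show ?thesis using 2 by (auto simp: hechler_def le_fun_def intro: order_trans)
    qed
    then show "((t, h), (t'', h'')) \<in> hechler"
      using 1 2 by (auto simp: hechler_def)
  qed
  then show ?thesis by (auto simp: preorder_on_def refl_on_def hechler_def)
qed

lemma hechler_compatible: "forcing_compatible UNIV hechler (t, h) (t, h')"
  unfolding forcing_compatible_def
  by (rule bexI[of _ "(t, sup h h')"]) (auto simp: hechler_def le_fun_def)

text \<open>Conditions with the same stem are compatible and there are only countably many stems, so
  one condition of \<open>D\<close> for each stem occurring in \<open>D\<close> is enough.\<close>

lemma hechler_proper: "proper_forcing UNIV hechler"
proof (rule ccc_proper)
  show "forcing_notion UNIV hechler" by (simp add: forcing_notion_def hechler_preorder)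
  fix D assume D: "forcing_dense UNIV hechler D"
  define a where "a t = (t, SOME h. (t, h) \<in> D)" for t
  have a: "(t, h) \<in> D \<Longrightarrow> a t \<in> D" for t h unfolding a_def by (rule someI[of "\<lambda>h. (t, h) \<in> D"])
  have "\<exists>b \<in> a ` fst ` D. forcing_compatible UNIV hechler (t, h) b" for t h
  proof -
    obtain t' h' where 1: "(t', h') \<in> D" "((t', h'), (t, h)) \<in> hechler"
      using D unfolding forcing_dense_def by (metis UNIV_I surj_pair)
    obtain s where "(s, (t', h')) \<in> hechler" "(s, a t') \<in> hechler"
      using hechler_compatible[of t' h'] unfolding a_def forcing_compatible_def by blast
    then have "forcing_compatible UNIV hechler (t, h) (a t')"
      using 1(2) hechler_preorder unfolding forcing_compatible_def preorder_on_def trans_def by blast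
    then show ?thesis using 1(1) by force
  qed
  then show "\<exists>A. countable A \<and> A \<subseteq> D \<and> (\<forall>s\<in>UNIV. \<exists>b\<in>A. forcing_compatible UNIV hechler s b)"
    using a by (intro exI[of _ "a ` fst ` D"]) auto
qed

lemma card_Un_countable_le_aleph1:
  assumes "|A| \<le>o cardSuc natLeq" "countable B"
  shows "|A \<union> B| \<le>o cardSuc natLeq"
proof (rule card_of_Un_ordLeq_infinite_Field)
  show "infinite (Field (cardSuc natLeq))"
    using cardSuc_finite[OF natLeq_Card_order] by (simp add: Field_natLeq)
  show "Card_order (cardSuc natLeq)" by (rule cardSuc_Card_order[OF natLeq_Card_order])
  obtain f :: "'a \<Rightarrow> nat" where "inj_on f B"
    using assms(2) by (rule countableE)
  then have "|B| \<le>o |UNIV :: nat set|" by (rule card_of_ordLeqI) simp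
  then have "|B| \<le>o natLeq" using card_of_nat by (rule ordLeq_ordIso_trans)
  then show "|B| \<le>o cardSuc natLeq"
    using cardSuc_ordLeq[OF natLeq_Card_order] by (rule ordLeq_transitive)
qed (use assms in auto)

text \<open>The bound is the generic function, read off as \<open>t n ! n\<close> from a stem in the
  filter that is longer than \<open>n\<close>. A condition in the filter whose promise dominates
  \<open>f\<close> forces this function above \<open>f\<close> beyond its own stem, as a common
  extension of the two conditions shows.\<close>

lemma PFA_bounded:
  assumes pfa: "PFA TYPE(nat list \<times> (nat \<Rightarrow> nat))" and F: "|F :: (nat \<Rightarrow> nat) set| \<le>o cardSuc natLeq"
  shows "\<exists>h. \<forall>f\<in>F. \<exists>n0. \<forall>n\<ge>n0. f n \<le> h n"
proof -
  define Df where "Df f = {(t :: nat list, h). f \<le> h}" for f :: "nat \<Rightarrow> nat"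
  define Dn where "Dn n = {(t :: nat list, h :: nat \<Rightarrow> nat). n \<le> length t}" for n
  have "forcing_dense UNIV hechler (Df f)" for f
    unfolding forcing_dense_def
  proof (intro conjI ballI)
    fix p :: "nat list \<times> (nat \<Rightarrow> nat)"
    show "\<exists>q\<in>Df f. (q, p) \<in> hechler"
      by (rule bexI[of _ "(fst p, sup f (snd p))"]) (auto simp: hechler_def Df_def split: prod.splits)
  qed auto
  moreover have "forcing_dense UNIV hechler (Dn n)" for n
    unfolding forcing_dense_def
  proof (intro conjI ballI)
    fix p :: "nat list \<times> (nat \<Rightarrow> nat)"
    obtain t h where p: "p = (t, h)" by fastforce
    show "\<exists>q\<in>Dn n. (q, p) \<in> hechler"
      unfolding p
      by (rule bexI[of _ "(t @ map h [length t..<length t + n], h)"])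
        (auto simp: hechler_def Dn_def nth_append)
  qed auto
  moreover have "|Df ` F \<union> range Dn| \<le>o cardSuc natLeq"
    using F card_of_image ordLeq_transitive by (blast intro: card_Un_countable_le_aleph1)
  ultimately have "\<exists>G. forcing_filter UNIV hechler G \<and> (\<forall>D\<in>Df ` F \<union> range Dn. G \<inter> D \<noteq> {})"
    using pfa[unfolded PFA_def, rule_format, OF hechler_proper, of "Df ` F \<union> range Dn"] by blast
  then obtain G where G: "forcing_filter UNIV hechler G" "\<And>f. f \<in> F \<Longrightarrow> G \<inter> Df f \<noteq> {}" "\<And>n. G \<inter> Dn n \<noteq> {}"
    by auto
  have dir: "\<exists>s\<in>G. (s, p) \<in> hechler \<and> (s, q) \<in> hechler" if "p \<in> G" "q \<in> G" for p q
    using G(1) that unfolding forcing_filter_def by blast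
  have "\<exists>t h. (t, h) \<in> G \<and> n < length t" for n
    using G(3)[of "Suc n"] unfolding Dn_def by (auto simp: Suc_le_eq)
  then obtain t h where th: "\<And>n. (t n, h n) \<in> G" "\<And>n. n < length (t n)" by metis
  show ?thesis
  proof (rule exI, intro ballI)
    fix f assume f: "f \<in> F"
    obtain t1 h1 where 1: "(t1, h1) \<in> G" "f \<le> h1" using G(2)[OF f] unfolding Df_def by auto
    then have "\<forall>n\<ge>length t1. f n \<le> t n ! n"
    proof (intro allI impI)
      fix n assume n: "length t1 \<le> n"
      obtain t3 h3 where 3: "((t3, h3), (t1, h1)) \<in> hechler" "((t3, h3), (t n, h n)) \<in> hechler"
        using dir[OF 1(1) th(1)[of n]] by auto
      then have "t3 ! n = t n ! n" "n < length t3" using th(2)[of n] by (auto simp: hechler_def nth_append)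
      moreover have "h1 n \<le> t3 ! n" using 3(1) n \<open>n < length t3\<close> by (auto simp: hechler_def)
      ultimately show "f n \<le> t n ! n" using le_funD[OF 1(2), of n] by simp
    qed
    then show "\<exists>n0. \<forall>n\<ge>n0. f n \<le> t n ! n" by blast
  qed
qed

section \<open>A proper forcing adding cliques to an open graph\<close>

lemma finite_subset_Union_mono:
  fixes A :: "nat \<Rightarrow> 'a set"
  assumes "finite G" "G \<subseteq> (\<Union>n. A n)" and mono: "\<And>m n. m \<le> n \<Longrightarrow> A m \<subseteq> A n"
  shows "\<exists>m\<ge>k. G \<subseteq> A m"
  using assms(1,2)
proof (induction G)
  case (insert x G)
  then obtain m n where m: "m \<ge> k" "G \<subseteq> A m" and n: "x \<in> A n" by auto
  have "A m \<subseteq> A (max m n)" "A n \<subseteq> A (max m n)" using mono by simp_all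
  then show ?case using m n by (intro exI[of _ "max m n"]) auto
qed auto

type_synonym 'x cond = "('x set \<times> ('x list \<Rightarrow> 'x set) set) \<times> ('x \<times> nat) set"

locale open_graph =
  fixes Z :: "'x set" and K :: "'x \<Rightarrow> 'x \<Rightarrow> bool" and b :: "nat \<Rightarrow> 'x set"
  assumes sym: "K x y \<Longrightarrow> K y x"
    and open_K: "K x y \<Longrightarrow> \<exists>k. x \<in> b k \<and> (\<forall>w\<in>b k. K w y)"
    and b_Int: "x \<in> b k \<Longrightarrow> x \<in> b l \<Longrightarrow> \<exists>m. x \<in> b m \<and> b m \<subseteq> b k \<inter> b l"
    and b_ex: "\<exists>k. x \<in> b k"
begin

definition free :: "'x set \<Rightarrow> bool" where
  "free C \<longleftrightarrow> (\<forall>x\<in>C. \<forall>y\<in>C. \<not> K x y)"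

text \<open>The numbers are colours, and only points of the same colour must be related. A new point
  can thus always enter with a fresh colour; in the end one of the countably many colours carries an
  uncountable clique.\<close>

definition clique :: "('x \<times> nat) set \<Rightarrow> bool" where
  "clique F \<longleftrightarrow> (\<forall>x y i. (x, i) \<in> F \<and> (y, i) \<in> F \<and> x \<noteq> y \<longrightarrow> K x y)"

definition inbox :: "'x list \<Rightarrow> nat list \<Rightarrow> bool" where
  "inbox as cs \<longleftrightarrow> list_all2 (\<lambda>a k. a \<in> b k) as cs"

text \<open>
  A pool consists of countably many points of \<open>Z\<close> and of countably many functions producing
  \<open>K\<close>-free sets.  The points added by an extension must, finitely many at a time, admit an
  order in which each of them avoids all the \<open>K\<close>-free sets computed from the old points and
  the preceding new ones.  Countable increasing unions of pools are pools again, and the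
  avoidance is what makes the finite parts of the conditions amalgamate.
\<close>

definition pool :: "'x set \<times> ('x list \<Rightarrow> 'x set) set \<Rightarrow> bool" where
  "pool \<sigma> \<longleftrightarrow> countable (fst \<sigma>) \<and> fst \<sigma> \<subseteq> Z \<and> countable (snd \<sigma>) \<and> (\<forall>\<xi>\<in>snd \<sigma>. \<forall>ws. free (\<xi> ws))"

definition ext :: "'x set \<times> ('x list \<Rightarrow> 'x set) set \<Rightarrow> 'x set \<times> ('x list \<Rightarrow> 'x set) set \<Rightarrow> bool" where
  "ext \<sigma>' \<sigma> \<longleftrightarrow> fst \<sigma> \<subseteq> fst \<sigma>' \<and> snd \<sigma> \<subseteq> snd \<sigma>' \<and>
     (\<forall>G. finite G \<and> G \<subseteq> fst \<sigma>' - fst \<sigma> \<longrightarrow>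
        (\<exists>gs. set gs = G \<and> distinct gs \<and>
           (\<forall>i<length gs. \<forall>\<xi>\<in>snd \<sigma>. \<forall>ws\<in>lists (fst \<sigma> \<union> set (take i gs)). gs ! i \<notin> \<xi> ws)))"

lemma extD:
  assumes "ext \<sigma>' \<sigma>"
  shows "fst \<sigma> \<subseteq> fst \<sigma>'" "snd \<sigma> \<subseteq> snd \<sigma>'"
    and "finite G \<Longrightarrow> G \<subseteq> fst \<sigma>' - fst \<sigma> \<Longrightarrow> \<exists>gs. set gs = G \<and> distinct gs \<and>
       (\<forall>i<length gs. \<forall>\<xi>\<in>snd \<sigma>. \<forall>ws\<in>lists (fst \<sigma> \<union> set (take i gs)). gs ! i \<notin> \<xi> ws)"
  using assms by (simp_all add: ext_def)

lemma ext_same: "snd \<sigma> \<subseteq> \<X> \<Longrightarrow> ext (fst \<sigma>, \<X>) \<sigma>"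
  by (auto simp: ext_def intro: exI[of _ "[]"])

lemma ext_refl: "ext \<sigma> \<sigma>"
  using ext_same[of \<sigma> "snd \<sigma>"] by simp

text \<open>The two orders are concatenated, with the points of the middle pool first. The later
  points avoid everything computed from the whole middle pool, hence also what the smallest pool
  computes with the help of the earlier points.\<close>

lemma ext_trans:
  assumes 1: "ext \<sigma>3 \<sigma>2" and 2: "ext \<sigma>2 \<sigma>1"
  shows "ext \<sigma>3 \<sigma>1"
  unfolding ext_def
proof (intro conjI allI impI)
  show "fst \<sigma>1 \<subseteq> fst \<sigma>3" "snd \<sigma>1 \<subseteq> snd \<sigma>3" using 1 2 by (auto simp: ext_def)
  fix G assume G: "finite G \<and> G \<subseteq> fst \<sigma>3 - fst \<sigma>1"
  have "finite (G \<inter> fst \<sigma>2)" "G \<inter> fst \<sigma>2 \<subseteq> fst \<sigma>2 - fst \<sigma>1" using G by auto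
  then obtain g1 where g1: "set g1 = G \<inter> fst \<sigma>2" "distinct g1"
    "\<forall>i<length g1. \<forall>\<xi>\<in>snd \<sigma>1. \<forall>ws\<in>lists (fst \<sigma>1 \<union> set (take i g1)). g1 ! i \<notin> \<xi> ws"
    using extD(3)[OF 2, of "G \<inter> fst \<sigma>2"] by blast
  have "finite (G - fst \<sigma>2)" "G - fst \<sigma>2 \<subseteq> fst \<sigma>3 - fst \<sigma>2" using G by auto
  then obtain g2 where g2: "set g2 = G - fst \<sigma>2" "distinct g2"
    "\<forall>i<length g2. \<forall>\<xi>\<in>snd \<sigma>2. \<forall>ws\<in>lists (fst \<sigma>2 \<union> set (take i g2)). g2 ! i \<notin> \<xi> ws"
    using extD(3)[OF 1, of "G - fst \<sigma>2"] by blast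
  show "\<exists>gs. set gs = G \<and> distinct gs \<and>
      (\<forall>i<length gs. \<forall>\<xi>\<in>snd \<sigma>1. \<forall>ws\<in>lists (fst \<sigma>1 \<union> set (take i gs)). gs ! i \<notin> \<xi> ws)"
  proof (intro exI[of _ "g1 @ g2"] conjI allI impI ballI)
    show "set (g1 @ g2) = G" "distinct (g1 @ g2)" using g1 g2 by auto
    fix i \<xi> ws assume i: "i < length (g1 @ g2)" and \<xi>: "\<xi> \<in> snd \<sigma>1"
      and ws: "ws \<in> lists (fst \<sigma>1 \<union> set (take i (g1 @ g2)))"
    show "(g1 @ g2) ! i \<notin> \<xi> ws"
    proof (cases "i < length g1")
      case True
      then show ?thesis using g1(3)[rule_format, OF True \<xi>, of ws] ws by (simp add: nth_append del: in_lists_conv_set)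
    next
      case False
      have "fst \<sigma>1 \<subseteq> fst \<sigma>2" "set g1 \<subseteq> fst \<sigma>2" using 2 g1(1) by (auto simp: ext_def)
      then have "fst \<sigma>1 \<union> set (take i (g1 @ g2)) \<subseteq> fst \<sigma>2 \<union> set (take (i - length g1) g2)"
        using False by auto
      then have "ws \<in> lists (fst \<sigma>2 \<union> set (take (i - length g1) g2))"
        using ws unfolding in_lists_conv_set by blast
      moreover have "\<xi> \<in> snd \<sigma>2" using \<xi> 2 by (auto simp: ext_def)
      ultimately show ?thesis using g2(3)[rule_format, of "i - length g1" \<xi> ws] False i by (simp add: nth_append del: in_lists_conv_set)
    qed
  qed
qed

lemma pool_chain:
  fixes s :: "nat \<Rightarrow> _"
  assumes ext: "\<And>n. ext (s (Suc n)) (s n)" and pool: "\<And>n. pool (s n)"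
  defines "u \<equiv> (\<Union>n. fst (s n), \<Union>n. snd (s n))"
  shows "pool u" "ext u (s n)"
proof -
  have "countable (fst (s n))" "fst (s n) \<subseteq> Z" "countable (snd (s n))" "\<xi> \<in> snd (s n) \<Longrightarrow> free (\<xi> ws)" for n \<xi> ws
    using pool[of n] by (simp_all add: pool_def)
  then show "pool u" unfolding pool_def u_def by auto
  have le: "m \<le> n \<Longrightarrow> ext (s n) (s m)" for m n
  proof (induction n)
    case (Suc n)
    then show ?case using ext_refl ext_trans[OF ext[of n]] by (cases "m = Suc n") simp_all
  qed (simp add: ext_refl)
  have mono: "m \<le> n \<Longrightarrow> fst (s m) \<subseteq> fst (s n)" for m n using extD(1)[OF le] .
  show "ext u (s n)"
    unfolding ext_def
  proof (intro conjI allI impI)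
    show "fst (s n) \<subseteq> fst u" "snd (s n) \<subseteq> snd u" by (auto simp: u_def)
    fix G assume G: "finite G \<and> G \<subseteq> fst u - fst (s n)"
    have "\<exists>m\<ge>n. G \<subseteq> fst (s m)"
      using G mono by (intro finite_subset_Union_mono) (auto simp: u_def)
    then obtain m where "n \<le> m" "G \<subseteq> fst (s m)" by blast
    then have "finite G" "G \<subseteq> fst (s m) - fst (s n)" using G by auto
    then show "\<exists>gs. set gs = G \<and> distinct gs \<and>
      (\<forall>i<length gs. \<forall>\<xi>\<in>snd (s n). \<forall>ws\<in>lists (fst (s n) \<union> set (take i gs)). gs ! i \<notin> \<xi> ws)"
      by (rule extD(3)[OF le[OF \<open>n \<le> m\<close>]])
  qed
qed

text \<open>The properties are decided one after the other along a countable chain of pools, and the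
  union of the chain is again a pool. Positive decisions survive by monotonicity, negative ones by
  transitivity of \<open>ext\<close>.\<close>

lemma pool_decide:
  assumes pool: "pool \<sigma>" and J: "countable J"
    and mono: "\<And>j \<sigma>' \<sigma>''. j \<in> J \<Longrightarrow> Q j \<sigma>' \<Longrightarrow> ext \<sigma>'' \<sigma>' \<Longrightarrow> Q j \<sigma>''"
  shows "\<exists>\<sigma>'. pool \<sigma>' \<and> ext \<sigma>' \<sigma> \<and> (\<forall>j\<in>J. Q j \<sigma>' \<or> (\<forall>\<sigma>''. pool \<sigma>'' \<and> ext \<sigma>'' \<sigma>' \<longrightarrow> \<not> Q j \<sigma>''))"
proof -
  define R where "R n \<tau> \<tau>' \<longleftrightarrow> (pool \<tau> \<longrightarrow> pool \<tau>' \<and> ext \<tau>' \<tau> \<and>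
      (Q (from_nat_into J n) \<tau>' \<or> (\<forall>\<sigma>''. pool \<sigma>'' \<and> ext \<sigma>'' \<tau>' \<longrightarrow> \<not> Q (from_nat_into J n) \<sigma>'')))" for n \<tau> \<tau>'
  have "\<exists>\<tau>'. R n \<tau> \<tau>'" for n \<tau>
  proof (cases "\<exists>\<sigma>''. pool \<sigma>'' \<and> ext \<sigma>'' \<tau> \<and> Q (from_nat_into J n) \<sigma>''")
    case False
    then show ?thesis using ext_refl[of \<tau>] unfolding R_def by (intro exI[of _ \<tau>]) simp
  next
    case True
    then obtain \<rho> where "pool \<rho>" "ext \<rho> \<tau>" "Q (from_nat_into J n) \<rho>" by (elim exE conjE)
    then show ?thesis unfolding R_def by (intro exI[of _ \<rho>]) simp
  qed
  then obtain f where f: "\<And>n \<tau>. R n \<tau> (f n \<tau>)" by metis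
  define s where "s = rec_nat \<sigma> f"
  have s: "s 0 = \<sigma>" "s (Suc n) = f n (s n)" for n by (simp_all add: s_def)
  have p: "pool (s n)" for n by (induction n) (use f in \<open>simp_all add: s pool R_def\<close>)
  have e: "ext (s (Suc n)) (s n)" for n using f[of n "s n"] p by (simp add: s R_def)
  define u where "u = (\<Union>n. fst (s n), \<Union>n. snd (s n))"
  have u: "pool u" "\<And>n. ext u (s n)" unfolding u_def using pool_chain[of s, OF e p] by auto
  have "Q j u \<or> (\<forall>\<sigma>''. pool \<sigma>'' \<and> ext \<sigma>'' u \<longrightarrow> \<not> Q j \<sigma>'')" if j: "j \<in> J" for j
  proof -
    obtain n where n: "from_nat_into J n = j" using from_nat_into_surj[OF J j] by blast
    have "Q j (s (Suc n)) \<or> (\<forall>\<sigma>''. pool \<sigma>'' \<and> ext \<sigma>'' (s (Suc n)) \<longrightarrow> \<not> Q j \<sigma>'')"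
      using f[of n "s n"] p[of n] unfolding n s(2) R_def by simp
    then show ?thesis
    proof
      assume "Q j (s (Suc n))"
      then show ?thesis using mono[OF j _ u(2)] by simp
    next
      assume no: "\<forall>\<sigma>''. pool \<sigma>'' \<and> ext \<sigma>'' (s (Suc n)) \<longrightarrow> \<not> Q j \<sigma>''"
      have "\<not> Q j \<sigma>''" if "pool \<sigma>''" "ext \<sigma>'' u" for \<sigma>''
        using no that(1) ext_trans[OF that(2) u(2)] by blast
      then show ?thesis by simp
    qed
  qed
  then show ?thesis using u(1) u(2)[of 0] unfolding s(1) by blast
qed

section \<open>Closures of sets of tuples\<close>

lemma finite_box:
  assumes "finite J" "\<And>j. j \<in> J \<Longrightarrow> K x (y j)"
  shows "\<exists>m. x \<in> b m \<and> (\<forall>j\<in>J. \<forall>w\<in>b m. K w (y j))"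
  using assms
proof (induction J)
  case empty
  then show ?case using b_ex by blast
next
  case (insert i J)
  then obtain m where m: "x \<in> b m" "\<forall>j\<in>J. \<forall>w\<in>b m. K w (y j)" by blast
  obtain k where k: "x \<in> b k" "\<forall>w\<in>b k. K w (y i)" using open_K[OF insert.prems[of i]] by blast
  obtain l where "x \<in> b l" "b l \<subseteq> b m \<inter> b k" using b_Int[OF m(1) k(1)] by blast
  then show ?case using m(2) k(2) by (intro exI[of _ l]) blast
qed

text \<open>Take the tuples of \<open>A\<close> whose last coordinates lie in the boxes
  \<open>cs\<close>, project them to the remaining coordinates and form the closure;
  \<open>der A ws cs\<close> is the section of this closure over \<open>ws\<close>.\<close>

definition der :: "'x list set \<Rightarrow> 'x list \<Rightarrow> nat list \<Rightarrow> 'x set" where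
  "der A ws cs = {z. \<forall>d. inbox (ws @ [z]) d \<longrightarrow> (\<exists>as\<in>A. inbox as (d @ cs))}"

text \<open>These are the points without a neighbour in the section cut down to \<open>b k\<close>.
  They always form a free set, so a pool may require new points to stay outside; a point of the
  section in \<open>b k\<close> that stays outside has a neighbour there.\<close>

definition avoid :: "'x list set \<Rightarrow> nat list \<Rightarrow> nat \<Rightarrow> 'x list \<Rightarrow> 'x set" where
  "avoid A cs k ws = {z \<in> der A ws cs \<inter> b k. \<forall>w\<in>der A ws cs \<inter> b k. \<not> K z w}"

lemma free_avoid: "free (avoid A cs k ws)"
  by (auto simp: free_def avoid_def)

text \<open>
  If the tuple \<open>gs\<close> lies in the closure of \<open>A\<close> and each entry avoids the free sets computed
  from \<open>A\<close> and the earlier entries, then, treating the coordinates from the last to the first,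
  one finds in \<open>A\<close> a tuple that is related to \<open>gs\<close> in every coordinate.
\<close>

lemma step_down:
  assumes cl: "\<And>cs. inbox gs cs \<Longrightarrow> \<exists>as\<in>A. inbox as cs"
    and near: "\<And>j. j < length gs \<Longrightarrow> gs ! j \<in> b (k j)"
    and avoid: "\<And>j cs. j < length gs \<Longrightarrow> gs ! j \<notin> avoid A cs (k j) (take j gs)"
  shows "\<exists>as\<in>A. length as = length gs \<and> (\<forall>j<length gs. as ! j \<in> b (k j) \<and> K (as ! j) (gs ! j))"
proof -
  let ?n = "length gs"
  \<comment> \<open>The boxes \<open>cs\<close> belong to the last \<open>i\<close> coordinates and
    are already so small that all their points are related to the corresponding entries of
    \<open>gs\<close>. The first coordinates are still only required to approximate
    \<open>gs\<close>.\<close>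
  have "\<exists>cs. length cs = i \<and> (\<forall>d. inbox (take (?n - i) gs) d \<longrightarrow> (\<exists>as\<in>A. inbox as (d @ cs))) \<and>
    (\<forall>j<i. \<forall>w\<in>b (cs ! j). w \<in> b (k (?n - i + j)) \<and> K w (gs ! (?n - i + j)))" if "i \<le> ?n" for i
    using that
  proof (induction i)
    case 0
    then show ?case using cl by simp
  next
    case (Suc i)
    then obtain cs where cs: "length cs = i"
      "\<forall>d. inbox (take (?n - i) gs) d \<longrightarrow> (\<exists>as\<in>A. inbox as (d @ cs))"
      "\<forall>j<i. \<forall>w\<in>b (cs ! j). w \<in> b (k (?n - i + j)) \<and> K w (gs ! (?n - i + j))"
      by auto
    define l where "l = ?n - Suc i"
    have l: "l < ?n" "?n - i = Suc l" using Suc.prems by (auto simp: l_def)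
    let ?D = "der A (take l gs) cs"
    have "gs ! l \<in> ?D"
      using cs(2) unfolding der_def l(2) take_Suc_conv_app_nth[OF l(1)] by blast
    \<comment> \<open>The entry \<open>gs ! l\<close> lies in the section but not in the free set,
      so it has a neighbour \<open>w\<close>. From here on \<open>w\<close> takes its place, and a
      small box around \<open>w\<close> settles coordinate \<open>l\<close>.\<close>
    then obtain w where w: "w \<in> ?D" "w \<in> b (k l)" "K (gs ! l) w"
      using near[OF l(1)] avoid[OF l(1), of cs] unfolding avoid_def by blast
    obtain m1 where m1: "w \<in> b m1" "\<forall>v\<in>b m1. K v (gs ! l)" using open_K[OF sym[OF w(3)]] by blast
    obtain m where m: "w \<in> b m" "b m \<subseteq> b m1 \<inter> b (k l)" using b_Int[OF m1(1) w(2)] by blast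
    show ?case
    proof (intro exI[of _ "m # cs"] conjI allI impI ballI)
      show "length (m # cs) = Suc i" using cs by simp
      fix d assume "inbox (take (?n - Suc i) gs) d"
      then have "inbox (take l gs @ [w]) (d @ [m])"
        using m(1) by (simp add: inbox_def l_def list_all2_appendI)
      then have "\<exists>as\<in>A. inbox as ((d @ [m]) @ cs)" using w(1) unfolding der_def by blast
      then show "\<exists>as\<in>A. inbox as (d @ m # cs)" by simp
    next
      fix j v assume j: "j < Suc i" and v: "v \<in> b ((m # cs) ! j)"
      have "v \<in> b (k (l + j)) \<and> K v (gs ! (l + j))"
      proof (cases j)
        case 0
        then show ?thesis using v m(2) m1(2) by auto
      next
        case (Suc j')
        then show ?thesis using cs(3)[rule_format, of j' v] v j unfolding l(2) by simp
      qed
      then show "v \<in> b (k (?n - Suc i + j))" "K v (gs ! (?n - Suc i + j))" by (simp_all add: l_def)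
    qed
  qed
  from this[of ?n] obtain cs where cs: "length cs = ?n"
    "\<forall>d. inbox [] d \<longrightarrow> (\<exists>as\<in>A. inbox as (d @ cs))"
    "\<forall>j<?n. \<forall>w\<in>b (cs ! j). w \<in> b (k j) \<and> K w (gs ! j)"
    by auto
  obtain as where as: "as \<in> A" "inbox as cs" using cs(2)[rule_format, of "[]"] by (auto simp: inbox_def)
  then have "length as = ?n" "\<forall>j<?n. as ! j \<in> b (cs ! j)"
    using cs(1) by (auto simp: inbox_def list_all2_conv_all_nth)
  then show ?thesis using as(1) cs(3) by blast
qed

section \<open>The forcing with pools and finite coloured cliques\<close>

definition conds :: "'x cond set" where
  "conds = {(\<sigma>, F). pool \<sigma> \<and> finite F \<and> fst ` F \<subseteq> fst \<sigma> \<and> clique F}"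

definition order :: "'x cond rel" where
  "order = {(p, q). p \<in> conds \<and> q \<in> conds \<and> ext (fst p) (fst q) \<and> snd q \<subseteq> snd p}"

lemma order_preorder: "preorder_on conds order"
  using ext_refl ext_trans unfolding preorder_on_def refl_on_def trans_def order_def by blast

text \<open>\<open>E\<close> is a pattern of coordinates and colours. Finite parts with the same
  pattern differ only in the tuple of points filled in, which leaves countably many patterns to
  consider.\<close>

definition inst :: "(nat \<times> nat) set \<Rightarrow> 'x list \<Rightarrow> ('x \<times> nat) set" where
  "inst E as = (\<lambda>(j, i). (as ! j, i)) ` E"

text \<open>Finite parts are sorted by their root over \<open>\<sigma>\<close>, the pattern of their
  other points and boxes around these. There are countably many such types, so one pool can decide
  which of them are realised in \<open>D\<close>, and \<open>W\<close> collects one witness for each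
  realised type. Adding the sets \<open>avoid\<close> of the witnesses to the pool puts the new
  points of a later \<open>s\<close> into the position required by \<open>step_down\<close>. The
  hypothesis on the old points of \<open>s\<close> ensures that its root was counted among the types
  over \<open>\<sigma>\<close>.\<close>

lemma decide_dense:
  assumes pool: "pool \<sigma>" and D: "D \<subseteq> conds"
  shows "\<exists>\<sigma>' W. pool \<sigma>' \<and> ext \<sigma>' \<sigma> \<and> countable W \<and> W \<subseteq> D \<and>
    (\<forall>s\<in>D. ext (fst s) \<sigma>' \<and> fst ` snd s \<inter> fst \<sigma>' \<subseteq> fst \<sigma> \<longrightarrow> (\<exists>e\<in>W. forcing_compatible conds order s e))"
proof -
  define J where "J = {R. finite R \<and> R \<subseteq> fst \<sigma> \<times> (UNIV :: nat set)} \<times>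
    {E :: (nat \<times> nat) set. finite E} \<times> (UNIV :: nat list set)"
  have J: "countable J"
    using pool countable_Collect_finite_subset[of "fst \<sigma> \<times> (UNIV :: nat set)"]
      countable_Collect_finite_subset[of "UNIV :: (nat \<times> nat) set"]
    unfolding J_def by (simp add: pool_def)
  define wit where "wit j \<tau> e as \<longleftrightarrow> 
      e \<in> D \<and> ext \<tau> (fst e) \<and> inbox as (snd (snd j)) \<and> snd e = fst j \<union> inst (fst (snd j)) as" for j \<tau> e as
  define Q where "Q j \<tau> \<longleftrightarrow> (\<exists>e as. wit j \<tau> e as)" for j \<tau>
  have "Q j \<tau>'" if "Q j \<tau>" "ext \<tau>' \<tau>" for j \<tau> \<tau>'
    using that ext_trans unfolding Q_def wit_def by blast
  then obtain \<tau> where \<tau>: "pool \<tau>" "ext \<tau> \<sigma>"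
    and dec: "\<And>j \<tau>'. j \<in> J \<Longrightarrow> \<not> Q j \<tau> \<Longrightarrow> pool \<tau>' \<Longrightarrow> ext \<tau>' \<tau> \<Longrightarrow> \<not> Q j \<tau>'"
    using pool_decide[OF pool J, of Q] by metis
  have "\<exists>e as. Q j \<tau> \<longrightarrow> wit j \<tau> e as" for j unfolding Q_def by blast
  then obtain e t where et: "\<And>j. Q j \<tau> \<Longrightarrow> wit j \<tau> (e j) (t j)" by metis
  \<comment> \<open>Tuples of the chosen witnesses with a given root and pattern, for all boxes
    together. This is the set whose closure will contain the tuple of new points of
    \<open>s\<close>.\<close>
  define A where "A R E = t ` {j \<in> J. Q j \<tau> \<and> fst j = R \<and> fst (snd j) = E}" for R E
  define \<X> where "\<X> = (\<lambda>(j, cs, k). avoid (A (fst j) (fst (snd j))) cs k) ` (J \<times> UNIV \<times> UNIV)"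
  define \<sigma>' where "\<sigma>' = (fst \<tau>, snd \<tau> \<union> \<X>)"
  define W where "W = e ` {j \<in> J. Q j \<tau>}"
  have "countable \<X>" unfolding \<X>_def using J by (intro countable_image countable_SIGMA) auto
  then have \<sigma>': "pool \<sigma>'" "ext \<sigma>' \<tau>"
    using \<tau>(1) free_avoid ext_same[of \<tau> "snd \<tau> \<union> \<X>"] unfolding \<sigma>'_def pool_def \<X>_def by auto
  have W: "countable W" "W \<subseteq> D"
    unfolding W_def using J et by (auto simp: wit_def)
  have "\<exists>e\<in>W. forcing_compatible conds order s e"
    if s: "s \<in> D" "ext (fst s) \<sigma>'" "fst ` snd s \<inter> fst \<sigma>' \<subseteq> fst \<sigma>" for s
  proof -
    obtain \<rho> F where sF: "s = (\<rho>, F)" by fastforce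
    have sc: "pool \<rho>" "finite F" "fst ` F \<subseteq> fst \<rho>" "clique F" using s(1) D unfolding sF conds_def by auto
    have ext_\<rho>: "ext \<rho> \<sigma>'" using s(2) by (simp add: sF)
    have "finite (fst ` F - fst \<sigma>')" "fst ` F - fst \<sigma>' \<subseteq> fst \<rho> - fst \<sigma>'" using sc by auto
    from extD(3)[OF ext_\<rho> this] obtain gs where gs: "set gs = fst ` F - fst \<sigma>'" "distinct gs"
      "\<forall>i<length gs. \<forall>\<xi>\<in>snd \<sigma>'. \<forall>ws\<in>lists (fst \<sigma>' \<union> set (take i gs)). gs ! i \<notin> \<xi> ws"
      by blast
    define R where "R = {f \<in> F. fst f \<in> fst \<sigma>'}"
    define E where "E = {(j, i). j < length gs \<and> (gs ! j, i) \<in> F}"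
    have "E \<subseteq> {..<length gs} \<times> snd ` F" unfolding E_def by force
    then have finE: "finite E" using sc(2) by (meson finite_SigmaI finite_imageI finite_lessThan finite_subset)
    have F: "F = R \<union> inst E gs"
    proof
      show "F \<subseteq> R \<union> inst E gs"
      proof
        fix f assume f: "f \<in> F"
        obtain x i where xi: "f = (x, i)" by fastforce
        show "f \<in> R \<union> inst E gs"
        proof (cases "x \<in> fst \<sigma>'")
          case False
          then have "x \<in> set gs" using f xi gs(1) by force
          then obtain j where "j < length gs" "gs ! j = x" by (metis in_set_conv_nth)
          then show ?thesis using f xi unfolding inst_def E_def by force
        qed (use f xi in \<open>simp add: R_def\<close>)
      qed
      show "R \<union> inst E gs \<subseteq> F" unfolding R_def E_def inst_def by auto
    qed
    have jJ: "(R, E, cs) \<in> J" for cs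
      using sc(2) finE s(3) unfolding J_def R_def sF by force
    \<comment> \<open>The condition \<open>s\<close> itself realises the type with boxes
      \<open>cs\<close> over its larger pool, so the negative decision is excluded and a witness was
      chosen below \<open>\<tau>\<close>.\<close>
    have clA: "\<exists>as\<in>A R E. inbox as cs" if cs: "inbox gs cs" for cs
    proof -
      have "wit (R, E, cs) \<rho> s gs"
        unfolding wit_def using s(1) ext_refl cs F by (simp add: sF)
      then have "Q (R, E, cs) \<tau>"
        using dec[OF jJ _ sc(1) ext_trans[OF ext_\<rho> \<sigma>'(2)]] unfolding Q_def by blast
      then show ?thesis
        using et[of "(R, E, cs)"] jJ[of cs] unfolding A_def wit_def by force
    qed
    \<comment> \<open>The coordinates that share a colour with \<open>j\<close>. A point replacing
      \<open>gs ! j\<close> must remain related to their entries, which holds throughout a small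
      enough box around \<open>gs ! j\<close>.\<close>
    define Js where "Js j = {j'. j' < length gs \<and> j' \<noteq> j \<and> (\<exists>i. (j, i) \<in> E \<and> (j', i) \<in> E)}" for j
    have KJs: "K (gs ! j) (gs ! j')" if jl: "j < length gs" "j' \<in> Js j" for j j'
    proof -
      obtain i where "(gs ! j, i) \<in> F" "(gs ! j', i) \<in> F" "gs ! j \<noteq> gs ! j'"
        using jl gs(2) unfolding Js_def E_def by (auto simp: nth_eq_iff_index_eq)
      then show ?thesis using sc(4) unfolding clique_def by blast
    qed
    have "\<exists>m. gs ! j \<in> b m \<and> (\<forall>j'\<in>Js j. \<forall>w\<in>b m. K w (gs ! j'))" if "j < length gs" for j
      using KJs[OF that] by (intro finite_box) (auto simp: Js_def)
    then obtain k where k: "\<And>j. j < length gs \<Longrightarrow> gs ! j \<in> b (k j)"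
      "\<And>j j' w. j < length gs \<Longrightarrow> j' \<in> Js j \<Longrightarrow> w \<in> b (k j) \<Longrightarrow> K w (gs ! j')" by metis
    have "gs ! j \<notin> avoid (A R E) cs (k j) (take j gs)" if "j < length gs" for j cs
    proof -
      have "avoid (A R E) cs (k j) \<in> snd \<sigma>'"
        unfolding \<sigma>'_def \<X>_def using jJ[of cs]
        by (simp, intro disjI2 rev_image_eqI[of "((R, E, cs), cs, k j)"]) simp_all
      moreover have "take j gs \<in> lists (fst \<sigma>' \<union> set (take j gs))" unfolding in_lists_conv_set by blast
      ultimately show ?thesis using gs(3) that by blast
    qed
    then obtain as where as: "as \<in> A R E" "length as = length gs"
      "\<And>j. j < length gs \<Longrightarrow> as ! j \<in> b (k j)" "\<And>j. j < length gs \<Longrightarrow> K (as ! j) (gs ! j)"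
      using step_down[of gs "A R E" k, OF clA k(1)] by blast
    then obtain j where j: "j \<in> J" "Q j \<tau>" "fst j = R" "fst (snd j) = E" "as = t j"
      unfolding A_def by blast
    obtain \<rho>' F' where e: "e j = (\<rho>', F')" by fastforce
    have w: "e j \<in> D" "ext \<tau> \<rho>'" "F' = R \<union> inst E as"
      using et[OF j(2)] e unfolding wit_def j(3,4) j(5)[symmetric] by auto
    have ec: "e j \<in> conds" "fst ` F' \<subseteq> fst \<rho>'" "finite F'" "clique F'"
      using w(1) D unfolding e conds_def by auto
    have ext': "ext \<rho> \<rho>'" using ext_trans[OF ext_trans[OF ext_\<rho> \<sigma>'(2)] w(2)] .
    \<comment> \<open>Root points belong to both cliques. For a new point of \<open>s\<close> and
      one of the witness, equal coordinates are related by \<open>step_down\<close>, different ones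
      by the choice of the boxes \<open>k\<close>.\<close>
    have cross: "K x y" if xy: "(x, i) \<in> F" "(y, i) \<in> F'" "x \<noteq> y" for x y i
    proof -
      consider "(y, i) \<in> F" | "(x, i) \<in> F'" | j j' where "x = gs ! j'" "(j', i) \<in> E" "y = as ! j" "(j, i) \<in> E"
        using xy unfolding w(3) F inst_def by auto
      then show ?thesis
      proof cases
        case 1
        then show ?thesis using xy sc(4) unfolding clique_def by blast
      next
        case 2
        then show ?thesis using xy ec(4) unfolding clique_def by blast
      next
        case (3 j j')
        then have jl: "j < length gs" "j' < length gs" by (auto simp: E_def)
        show ?thesis
        proof (cases "j = j'")
          case True
          then show ?thesis using sym[OF as(4)[OF jl(1)]] 3 by simp
        next
          case False
          then have "j' \<in> Js j" using 3 jl by (auto simp: Js_def)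
          then show ?thesis using sym[OF k(2)[OF jl(1) _ as(3)[OF jl(1)]]] 3 by simp
        qed
      qed
    qed
    have "clique (F \<union> F')"
      unfolding clique_def
    proof (intro allI impI, elim conjE)
      fix x y i assume "(x, i) \<in> F \<union> F'" "(y, i) \<in> F \<union> F'" and xy: "x \<noteq> y"
      then consider "(x, i) \<in> F" "(y, i) \<in> F" | "(x, i) \<in> F" "(y, i) \<in> F'"
        | "(x, i) \<in> F'" "(y, i) \<in> F" | "(x, i) \<in> F'" "(y, i) \<in> F'" by blast
      then show "K x y"
      proof cases
        case 1
        then show ?thesis using xy sc(4) unfolding clique_def by blast
      next
        case 2
        then show ?thesis using xy by (intro cross)
      next
        case 3
        then show ?thesis using xy by (intro sym[OF cross]) auto
      next
        case 4
        then show ?thesis using xy ec(4) unfolding clique_def by blast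
      qed
    qed
    moreover have "fst ` F' \<subseteq> fst \<rho>" using ec(2) extD(1)[OF ext'] by blast
    ultimately have "(\<rho>, F \<union> F') \<in> conds" using sc ec(3) unfolding conds_def by auto
    moreover have "s \<in> conds" using s(1) D by blast
    ultimately have "forcing_compatible conds order s (e j)"
      unfolding forcing_compatible_def order_def using ec(1) ext' ext_refl[of \<rho>] unfolding sF e
      by (intro bexI[of _ "(\<rho>, F \<union> F')"]) simp_all
    then show ?thesis using j unfolding W_def by blast
  qed
  then show ?thesis using \<sigma>' \<tau>(2) W ext_trans[OF \<sigma>'(2) \<tau>(2)] by (intro exI[of _ \<sigma>'] exI[of _ W]) simp
qed

lemma conds_ext:
  assumes "p \<in> conds" "pool \<sigma>" "ext \<sigma> (fst p)"
  shows "(\<sigma>, snd p) \<in> conds"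
proof -
  obtain \<rho> F where "p = (\<rho>, F)" by fastforce
  then show ?thesis using assms extD(1)[OF assms(3)] unfolding conds_def by auto
qed

text \<open>The models are closed under the choices made by \<open>decide_dense\<close>. Only the
  pool of \<open>p\<close> grows, along an enumeration of the sets of conditions in the model;
  \<open>p\<close> with the union of these pools is the master condition.\<close>

lemma order_proper: "proper_forcing conds order"
proof -
  define good where "good D \<sigma> \<sigma>' W \<longleftrightarrow> pool \<sigma>' \<and> ext \<sigma>' \<sigma> \<and> countable W \<and> W \<subseteq> D \<and>
    (\<forall>s\<in>D. ext (fst s) \<sigma>' \<and> fst ` snd s \<inter> fst \<sigma>' \<subseteq> fst \<sigma> \<longrightarrow> (\<exists>e\<in>W. forcing_compatible conds order s e))"
    for D \<sigma> \<sigma>' W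
  have "\<exists>x. D \<subseteq> conds \<longrightarrow> pool \<sigma> \<longrightarrow> good D \<sigma> (fst x) (snd x)" for D \<sigma>
  proof (cases "D \<subseteq> conds \<and> pool \<sigma>")
    case True
    have "\<exists>\<sigma>' W. good D \<sigma> \<sigma>' W" unfolding good_def by (intro decide_dense) (use True in auto)
    then obtain \<sigma>' W where "good D \<sigma> \<sigma>' W" by (elim exE)
    then show ?thesis by (intro exI[of _ "(\<sigma>', W)"]) simp
  qed blast
  then obtain \<Psi> where \<Psi>: "\<And>D \<sigma>. D \<subseteq> conds \<Longrightarrow> pool \<sigma> \<Longrightarrow> good D \<sigma> (fst (\<Psi> D \<sigma>)) (snd (\<Psi> D \<sigma>))" by metis
  let ?W = "Inl ` conds \<union> Inr ` Pow conds"
  define g :: "'x cond + 'x cond set \<Rightarrow> 'x cond + 'x cond set \<Rightarrow> ('x cond + 'x cond set) set" where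
    "g a c = (case (a, c) of (Inl p, Inr D) \<Rightarrow>
       insert (Inl (fst (\<Psi> D (fst p)), snd p)) (Inl ` snd (\<Psi> D (fst p))) | _ \<Rightarrow> {})" for a c
  define C where "C = {M. countable M \<and> M \<subseteq> ?W \<and> {Inr conds} \<subseteq> M \<and> (\<forall>a\<in>M. \<forall>c\<in>M. g a c \<subseteq> M)}"
  have "countable (g a c) \<and> g a c \<subseteq> ?W" if ac: "a \<in> ?W" "c \<in> ?W" for a c
  proof (cases "\<exists>p D. a = Inl p \<and> c = Inr D")
    case True
    then obtain p D where pD: "a = Inl p" "c = Inr D" "p \<in> conds" "D \<subseteq> conds" using ac by auto
    have "pool (fst p)" using pD(3) by (auto simp: conds_def)
    then have \<psi>: "good D (fst p) (fst (\<Psi> D (fst p))) (snd (\<Psi> D (fst p)))" using \<Psi> pD(4) by blast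
    then have "(fst (\<Psi> D (fst p)), snd p) \<in> conds"
      unfolding good_def by (intro conds_ext[OF pD(3)]) simp_all
    then show ?thesis using \<psi> pD(4) unfolding g_def good_def pD(1,2) by auto
  next
    case False
    then have "g a c = {}" unfolding g_def by (auto split: sum.splits)
    then show ?thesis by simp
  qed
  then have "club_countable ?W C"
    unfolding C_def by (intro club_countable_closed) simp_all
  moreover have "\<exists>q. (q, p) \<in> order \<and> master_condition conds order M q" if M: "M \<in> C" and p: "Inl p \<in> M" for M p
  proof -
    have MW: "M \<subseteq> ?W" "countable M" "Inr conds \<in> M" and Mg: "\<And>a c. a \<in> M \<Longrightarrow> c \<in> M \<Longrightarrow> g a c \<subseteq> M"
      using M unfolding C_def by auto
    have pc: "p \<in> conds" using MW(1) p by auto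
    define \<D> where "\<D> = {D. Inr D \<in> M}"
    have "countable \<D>" unfolding \<D>_def
      using countable_image_inj_on[of Inr \<D>] MW(2) countable_subset[of "Inr ` \<D>" M] unfolding \<D>_def by (auto simp: inj_on_def)
    have "\<D> \<noteq> {}" using MW(3) by (auto simp: \<D>_def)
    \<comment> \<open>Every set must recur infinitely often: the points of a given condition that
      lie in the union pool are present from some stage on, and its dense set has to be treated
      after that stage.\<close>
    define d where "d n = from_nat_into \<D> (fst (prod_decode n))" for n
    have d: "d n \<in> \<D>" for n unfolding d_def by (rule from_nat_into[OF \<open>\<D> \<noteq> {}\<close>])
    have d_inf: "\<exists>n\<ge>m. d n = D" if DD: "D \<in> \<D>" for D m
    proof -
      obtain a where "from_nat_into \<D> a = D" using from_nat_into_surj[OF \<open>countable \<D>\<close> DD] by blast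
      then show ?thesis by (intro exI[of _ "prod_encode (a, m)"]) (simp add: d_def le_prod_encode_2)
    qed
    have dc: "d n \<subseteq> conds" "Inr (d n) \<in> M" for n using d[of n] MW(1) unfolding \<D>_def by auto
    define s where "s = rec_nat (fst p) (\<lambda>n \<sigma>. fst (\<Psi> (d n) \<sigma>))"
    have s: "s 0 = fst p" "s (Suc n) = fst (\<Psi> (d n) (s n))" for n by (simp_all add: s_def)
    have sM: "Inl (s n, snd p) \<in> M" for n
    proof (induction n)
      case (Suc n)
      then show ?case using Mg[OF Suc dc(2)[of n]] unfolding g_def s(2) by simp
    qed (use p s in simp)
    then have sp: "(s n, snd p) \<in> conds" for n using MW(1) by auto
    then have pool: "pool (s n)" for n by (auto simp: conds_def)
    have gd: "good (d n) (s n) (s (Suc n)) (snd (\<Psi> (d n) (s n)))" for n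
      using \<Psi>[OF dc(1) pool] unfolding s(2) .
    then have ext: "ext (s (Suc n)) (s n)" for n unfolding good_def by blast
    define u where "u = (\<Union>n. fst (s n), \<Union>n. snd (s n))"
    have u: "pool u" "\<And>n. ext u (s n)" unfolding u_def using pool_chain[of s, OF ext pool] by auto
    have uc: "(u, snd p) \<in> conds" using conds_ext[OF pc u(1)] u(2)[of 0] s(1) by simp
    have mono: "m \<le> n \<Longrightarrow> fst (s m) \<subseteq> fst (s n)" for m n
      by (rule lift_Suc_mono_le[of "\<lambda>n. fst (s n)"]) (use extD(1)[OF ext] in auto)
    have "predense_below conds order {p \<in> D. Inl p \<in> M} (u, snd p)"
      if D: "forcing_dense conds order D" "Inr D \<in> M" for D
      unfolding predense_below_def
    proof (intro ballI impI)
      fix t assume t: "t \<in> conds" "(t, (u, snd p)) \<in> order"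
      obtain t' where t': "t' \<in> D" "(t', t) \<in> order" using D(1) t(1) unfolding forcing_dense_def by blast
      have tu: "ext (fst t') u" using t(2) t'(2) ext_trans[of "fst t'" "fst t" u] unfolding order_def by simp
      have "finite (fst ` snd t' \<inter> fst u)" using t' D(1) unfolding forcing_dense_def conds_def by auto
      moreover have "fst ` snd t' \<inter> fst u \<subseteq> (\<Union>n. fst (s n))" by (auto simp: u_def)
      ultimately obtain m where m: "fst ` snd t' \<inter> fst u \<subseteq> fst (s m)"
        using finite_subset_Union_mono[of _ "\<lambda>n. fst (s n)", OF _ _ mono] by blast
      obtain n where n: "n \<ge> m" "d n = D" using d_inf[of D m] D(2) by (auto simp: \<D>_def)
      have "fst ` snd t' \<inter> fst (s (Suc n)) \<subseteq> fst (s n)"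
        using m mono[OF n(1)] extD(1)[OF u(2)[of "Suc n"]] by blast
      moreover have "ext (fst t') (s (Suc n))" using ext_trans[OF tu u(2)] .
      ultimately obtain e where e: "e \<in> snd (\<Psi> D (s n))" "forcing_compatible conds order t' e"
        using gd[of n] t'(1) unfolding good_def n(2) by blast
      have "e \<in> D" using gd[of n] e(1) unfolding good_def n(2) by blast
      moreover have "Inl e \<in> M" using Mg[OF sM D(2), of n] e(1) unfolding g_def by auto
      moreover have "forcing_compatible conds order t e"
        using e(2) t'(2) order_preorder unfolding forcing_compatible_def preorder_on_def trans_def by blast
      ultimately show "\<exists>e\<in>{p \<in> D. Inl p \<in> M}. forcing_compatible conds order t e" by blast
    qed
    then have "master_condition conds order M (u, snd p)" using uc unfolding master_condition_def by blast
    moreover have "((u, snd p), p) \<in> order" using uc pc u(2)[of 0] s(1) by (simp add: order_def)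
    ultimately show ?thesis by blast
  qed
  moreover have "conds \<noteq> {}"
  proof -
    have "(({}, {}), {}) \<in> conds" by (simp add: conds_def pool_def clique_def)
    then show ?thesis by blast
  qed
  ultimately show ?thesis using order_preorder unfolding proper_forcing_def forcing_notion_def by blast
qed

text \<open>Meeting a label is dense: \<open>new\<close> gives a point outside the countably many
  free sets which a pool computes from its own points, so this point may join the pool, and a fresh
  colour makes the clique condition vacuous for it.\<close>

lemma PFA_clique:
  fixes lab :: "'x \<Rightarrow> 'l"
  assumes pfa: "PFA TYPE('x cond)"
    and \<Lambda>: "|\<Lambda>| \<le>o cardSuc natLeq"
    and new: "\<And>l \<C>. l \<in> \<Lambda> \<Longrightarrow> countable \<C> \<Longrightarrow> \<forall>C\<in>\<C>. free C \<Longrightarrow> \<exists>x\<in>Z. lab x = l \<and> x \<notin> \<Union>\<C>"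
  shows "\<exists>x i. \<forall>l\<in>\<Lambda>. x l \<in> Z \<and> lab (x l) = l \<and> (\<forall>m\<in>\<Lambda>. l \<noteq> m \<and> i l = (i m :: nat) \<longrightarrow> K (x l) (x m))"
proof -
  define D where "D l = {p \<in> conds. \<exists>x i. lab x = l \<and> (x, i) \<in> snd p}" for l
  have "forcing_dense conds order (D l)" if l: "l \<in> \<Lambda>" for l
    unfolding forcing_dense_def
  proof (intro conjI ballI)
    fix p assume p: "p \<in> conds"
    obtain N \<X> F where p_eq: "p = ((N, \<X>), F)" by (metis surj_pair)
    have pc: "countable N" "N \<subseteq> Z" "countable \<X>" "\<And>\<xi> ws. \<xi> \<in> \<X> \<Longrightarrow> free (\<xi> ws)" "finite F" "fst ` F \<subseteq> N" "clique F"
      using p unfolding p_eq conds_def pool_def by auto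
    define \<C> where "\<C> = (\<lambda>(\<xi>, ws). \<xi> ws) ` (\<X> \<times> lists N)"
    have "countable \<C>" unfolding \<C>_def using pc by (intro countable_image countable_SIGMA countable_lists) auto
    moreover have "\<forall>C\<in>\<C>. free C" using pc(4) by (auto simp: \<C>_def)
    ultimately obtain x where x: "x \<in> Z" "lab x = l" "x \<notin> \<Union>\<C>" using new[OF l] by blast
    obtain i where i: "i \<notin> snd ` F" using pc(5) ex_new_if_finite[of "snd ` F"] by auto
    define q where "q = ((insert x N, \<X>), insert (x, i) F)"
    have "clique (insert (x, i) F)"
      using pc(7) i unfolding clique_def by (auto simp: image_iff)
    then have qc: "q \<in> conds" using pc x(1) unfolding q_def conds_def pool_def by auto
    have "ext (insert x N, \<X>) (N, \<X>)"
      unfolding ext_def fst_conv snd_conv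
    proof (intro conjI allI impI)
      fix G assume "finite G \<and> G \<subseteq> insert x N - N"
      then have "G = {} \<or> G = {x}" by blast
      then show "\<exists>gs. set gs = G \<and> distinct gs \<and>
          (\<forall>i<length gs. \<forall>\<xi>\<in>\<X>. \<forall>ws\<in>lists (N \<union> set (take i gs)). gs ! i \<notin> \<xi> ws)"
      proof
        assume "G = {x}"
        moreover have "x \<notin> \<xi> ws" if "\<xi> \<in> \<X>" "ws \<in> lists N" for \<xi> ws
          using x(3) that unfolding \<C>_def by blast
        ultimately show ?thesis by (intro exI[of _ "[x]"]) (simp del: in_lists_conv_set)
      qed (intro exI[of _ "[]"], simp)
    qed auto
    then have "(q, p) \<in> order" using qc p unfolding order_def q_def p_eq by auto
    moreover have "q \<in> D l" using qc x(2) unfolding D_def q_def by auto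
    ultimately show "\<exists>q\<in>D l. (q, p) \<in> order" by blast
  qed (auto simp: D_def)
  then have "\<forall>E\<in>D ` \<Lambda>. forcing_dense conds order E" by blast
  moreover have "|D ` \<Lambda>| \<le>o cardSuc natLeq" using card_of_image \<Lambda> by (rule ordLeq_transitive)
  ultimately have "\<exists>G. forcing_filter conds order G \<and> (\<forall>E\<in>D ` \<Lambda>. G \<inter> E \<noteq> {})"
    using pfa[unfolded PFA_def, rule_format, OF order_proper, of "D ` \<Lambda>"] by simp
  then obtain G where G: "forcing_filter conds order G" "\<And>l. l \<in> \<Lambda> \<Longrightarrow> G \<inter> D l \<noteq> {}"
    by auto
  have "\<exists>y. l \<in> \<Lambda> \<longrightarrow> lab (fst y) = l \<and> (\<exists>p\<in>G. y \<in> snd p)" for l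
  proof (cases "l \<in> \<Lambda>")
    case True
    then obtain p where "p \<in> G" "p \<in> D l" using G(2) by blast
    then obtain x i where "lab x = l" "(x, i) \<in> snd p" unfolding D_def by blast
    then show ?thesis using \<open>p \<in> G\<close> by (intro exI[of _ "(x, i)"]) auto
  qed simp
  then obtain y where y: "\<And>l. l \<in> \<Lambda> \<Longrightarrow> lab (fst (y l)) = l" "\<And>l. l \<in> \<Lambda> \<Longrightarrow> \<exists>p\<in>G. y l \<in> snd p" by metis
  have GC: "G \<subseteq> conds" using G(1) unfolding forcing_filter_def by blast
  have "fst (y l) \<in> Z" if l: "l \<in> \<Lambda>" for l
  proof -
    obtain p where "p \<in> G" "y l \<in> snd p" using y(2)[OF l] by blast
    moreover from this have "p \<in> conds" using GC by blast
    ultimately show ?thesis unfolding conds_def pool_def by force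
  qed
  moreover have "K (fst (y l)) (fst (y m))" if lm: "l \<in> \<Lambda>" "m \<in> \<Lambda>" "l \<noteq> m" "snd (y l) = snd (y m)" for l m
  proof -
    obtain p q where "p \<in> G" "y l \<in> snd p" "q \<in> G" "y m \<in> snd q" using y(2) lm by blast
    moreover from this obtain s where "s \<in> G" "(s, p) \<in> order" "(s, q) \<in> order"
      using G(1) unfolding forcing_filter_def by blast
    ultimately have "y l \<in> snd s" "y m \<in> snd s" "clique (snd s)" using GC unfolding order_def conds_def by auto
    moreover have "fst (y l) \<noteq> fst (y m)" using y(1) lm by metis
    ultimately show ?thesis using lm(4) unfolding clique_def by (metis prod.collapse)
  qed
  ultimately show ?thesis using y(1) by (intro exI[of _ "\<lambda>l. fst (y l)"] exI[of _ "\<lambda>l. snd (y l)"]) blast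
qed

end

section \<open>Open colouring from PFA\<close>

lemma inj_Baire_sets: "\<exists>e :: (nat \<Rightarrow> nat) \<times> nat set \<Rightarrow> nat set. inj e"
proof -
  define h where "h x = {k. case prod_decode k of (n, m) \<Rightarrow> if n = 0 then m \<in> snd x else m = fst x (n - 1)}"
    for x :: "(nat \<Rightarrow> nat) \<times> nat set"
  have 1: "m \<in> snd x \<longleftrightarrow> prod_encode (0, m) \<in> h x" for x m by (simp add: h_def)
  have 2: "m = fst x n \<longleftrightarrow> prod_encode (Suc n, m) \<in> h x" for x n m by (simp add: h_def)
  have "inj h"
  proof (rule injI)
    fix x y assume eq: "h x = h y"
    have "snd x = snd y"
    proof (rule set_eqI)
      show "m \<in> snd x \<longleftrightarrow> m \<in> snd y" for m using 1[of m x] 1[of m y] eq by metis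
    qed
    moreover have "fst x = fst y"
    proof
      show "fst x n = fst y n" for n using 2[of "fst x n" x n] 2[of "fst x n" y n] eq by metis
    qed
    ultimately show "x = y" by (rule prod_eqI[rotated])
  qed
  then show ?thesis by blast
qed

lemma inj_set_lists_real: "\<exists>cd :: nat set list \<Rightarrow> real. inj cd"
proof -
  define h where "h xs = {k. case prod_decode k of (n, m) \<Rightarrow>
      if n = 0 then m < length xs else n \<le> length xs \<and> m \<in> xs ! (n - 1)}" for xs :: "nat set list"
  have 1: "m < length xs \<longleftrightarrow> prod_encode (0, m) \<in> h xs" for xs m by (simp add: h_def)
  have 2: "n < length xs \<and> m \<in> xs ! n \<longleftrightarrow> prod_encode (Suc n, m) \<in> h xs" for n m xs
    unfolding h_def by (simp add: Suc_le_eq)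
  have "inj h"
  proof (rule injI)
    fix xs ys assume eq: "h xs = h ys"
    then have "m < length xs \<longleftrightarrow> m < length ys" for m using 1[of m xs] 1[of m ys] by simp
    from this[of "length xs"] this[of "length ys"] have len: "length xs = length ys" by simp
    moreover have "xs ! n = ys ! n" if "n < length xs" for n
    proof (rule set_eqI)
      show "m \<in> xs ! n \<longleftrightarrow> m \<in> ys ! n" for m
        using 2[where n=n and m=m and xs=xs] 2[where n=n and m=m and xs=ys] eq len that by metis
    qed
    ultimately show "xs = ys" by (simp add: list_eq_iff_nth_eq)
  qed
  moreover obtain g :: "nat set \<Rightarrow> real" where "inj g"
    using eqpoll_imp_lepoll[OF nat_sets_eqpoll_reals] unfolding lepoll_def by blast
  ultimately have "inj (g \<circ> h)" by (intro inj_compose)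
  then show ?thesis by blast
qed

text \<open>This is the Kuratowski pair of \<open>{a}\<close> and \<open>b\<close>; the singleton
  lets \<open>a\<close> be one level of sets lower than \<open>b\<close>.\<close>

lemma kuratowski_pair: "{{{a}}, {{a}, b}} = {{{a'}}, {{a'}, b'}} \<longleftrightarrow> a = a' \<and> b = b'"
  by (auto simp: doubleton_eq_iff)

lemma PFA_cond:
  assumes pfa: "PFA TYPE(real set set set set)"
  shows "PFA TYPE(((nat \<Rightarrow> nat) \<times> nat set) cond)"
proof -
  obtain e :: "(nat \<Rightarrow> nat) \<times> nat set \<Rightarrow> nat set" where e: "inj e" using inj_Baire_sets by blast
  obtain cd :: "nat set list \<Rightarrow> real" where cd: "inj cd" using inj_set_lists_real by blast
  \<comment> \<open>Lists of length one hold the points of the pool and lists of length two the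
    coloured points, so a single set of reals records both.\<close>
  define A where "A c = {cd [e x] |x. x \<in> fst (fst c)} \<union> {cd [e x, {n}] |x n. (x, n) \<in> snd c}"
    for c :: "((nat \<Rightarrow> nat) \<times> nat set) cond"
  define G where "G \<xi> = {cd (e y # map e ws) |ws y. y \<in> \<xi> ws}"
    for \<xi> :: "((nat \<Rightarrow> nat) \<times> nat set) list \<Rightarrow> ((nat \<Rightarrow> nat) \<times> nat set) set"
  define f where "f c = {{{A c}}, {{A c}, G ` snd (fst c)}}" for c
  have A1: "x \<in> fst (fst c) \<longleftrightarrow> cd [e x] \<in> A c" for x c
    unfolding A_def by (cases x) (auto simp: inj_eq[OF cd] inj_eq[OF e])
  have A2: "(x, n) \<in> snd c \<longleftrightarrow> cd [e x, {n}] \<in> A c" for x n c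
    unfolding A_def by (cases x) (auto simp: inj_eq[OF cd] inj_eq[OF e])
  have G: "y \<in> \<xi> ws \<longleftrightarrow> cd (e y # map e ws) \<in> G \<xi>" for y \<xi> ws
    unfolding G_def by (cases y) (auto simp: inj_eq[OF cd] inj_eq[OF e] inj_map_eq_map[OF e])
  have injG: "inj G"
  proof (rule injI)
    fix \<xi> \<xi>' assume "G \<xi> = G \<xi>'"
    then have "y \<in> \<xi> ws \<longleftrightarrow> y \<in> \<xi>' ws" for y ws using G[of y \<xi> ws] G[of y \<xi>' ws] by simp
    then show "\<xi> = \<xi>'" by (intro ext set_eqI)
  qed
  have "inj f"
  proof (rule injI)
    fix c c' assume "f c = f c'"
    then have *: "A c = A c'" "G ` snd (fst c) = G ` snd (fst c')"
      unfolding f_def by (simp_all only: kuratowski_pair)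
    have "x \<in> fst (fst c) \<longleftrightarrow> x \<in> fst (fst c')" for x using A1[of x c] A1[of x c'] *(1) by simp
    then have "fst (fst c) = fst (fst c')" by (intro set_eqI)
    moreover have "(x, n) \<in> snd c \<longleftrightarrow> (x, n) \<in> snd c'" for x n using A2[of x n c] A2[of x n c'] *(1) by simp
    then have "snd c = snd c'" by (intro set_eqI) (simp add: split_paired_all)
    moreover have "snd (fst c) = snd (fst c')" using *(2) injG by (simp add: inj_image_eq_iff)
    ultimately show "c = c'" by (simp add: prod_eq_iff)
  qed
  then show ?thesis by (rule PFA_transfer[OF pfa])
qed

lemma PFA_hechler:
  assumes pfa: "PFA TYPE(real set set set set)"
  shows "PFA TYPE(nat list \<times> (nat \<Rightarrow> nat))"
proof -
  obtain e :: "(nat \<Rightarrow> nat) \<times> nat set \<Rightarrow> nat set" where e: "inj e" using inj_Baire_sets by blast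
  obtain cd :: "nat set list \<Rightarrow> real" where cd: "inj cd" using inj_set_lists_real by blast
  have "inj (\<lambda>c. {{{{cd [e (snd c, {to_nat (fst c :: nat list)})]}}}})"
    by (intro injI) (simp add: inj_eq[OF cd] inj_eq[OF e] prod_eq_iff)
  then show ?thesis by (rule PFA_transfer[OF pfa])
qed

lemma ex_aleph1_set: "\<exists>\<Lambda> :: nat set set. |\<Lambda>| \<le>o cardSuc natLeq \<and> uncountable \<Lambda>"
proof -
  have nl: "\<not> |UNIV :: nat set set| \<le>o natLeq"
  proof
    assume "|UNIV :: nat set set| \<le>o natLeq"
    then have "|UNIV :: nat set set| \<le>o |UNIV :: nat set|"
      using ordIso_symmetric[OF card_of_nat] by (rule ordLeq_ordIso_trans)
    then obtain f :: "nat set \<Rightarrow> nat" where "inj f" unfolding card_of_ordLeq[symmetric] by auto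
    then have "range (inv f) = Pow (UNIV :: nat set)" using inj_imp_surj_inv by simp
    then show False using Cantors_theorem by blast
  qed
  then have "natLeq <o |UNIV :: nat set set|"
    using not_ordLeq_iff_ordLess[OF natLeq_Well_order card_of_Well_order] by blast
  then have le: "cardSuc natLeq \<le>o |UNIV :: nat set set|"
    by (rule cardSuc_least[OF natLeq_Card_order card_of_Card_order])
  have iso: "|Field (cardSuc natLeq)| =o cardSuc natLeq"
    by (rule card_of_Field_ordIso[OF cardSuc_Card_order[OF natLeq_Card_order]])
  have "|Field (cardSuc natLeq)| \<le>o |UNIV :: nat set set|"
    by (rule ordIso_ordLeq_trans[OF iso le])
  then have "\<exists>f :: nat set \<Rightarrow> nat set. inj_on f (Field (cardSuc natLeq)) \<and> f ` Field (cardSuc natLeq) \<subseteq> UNIV"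
    by (rule iffD2[OF card_of_ordLeq])
  then obtain f :: "nat set \<Rightarrow> nat set" where f: "inj_on f (Field (cardSuc natLeq))" by (elim exE conjE)
  let ?\<Lambda> = "f ` Field (cardSuc natLeq)"
  have "|?\<Lambda>| \<le>o cardSuc natLeq" using card_of_image iso by (rule ordLeq_ordIso_trans)
  moreover have "uncountable ?\<Lambda>"
  proof
    assume "countable ?\<Lambda>"
    then have "countable (Field (cardSuc natLeq))" using f by (rule countable_image_inj_on)
    then obtain g :: "nat set \<Rightarrow> nat" where "inj_on g (Field (cardSuc natLeq))" by (rule countableE)
    then have "|Field (cardSuc natLeq)| \<le>o |UNIV :: nat set|" by (rule card_of_ordLeqI) simp
    then have "|Field (cardSuc natLeq)| \<le>o natLeq"
      using card_of_nat by (rule ordLeq_ordIso_trans)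
    then have "cardSuc natLeq \<le>o natLeq"
      by (rule ordIso_ordLeq_trans[OF ordIso_symmetric[OF iso]])
    then show False using not_ordLess_ordLeq[OF cardSuc_greater[OF natLeq_Card_order]] by simp
  qed
  ultimately show ?thesis by blast
qed

theorem PFA_open_coloring:
  fixes Z :: "(nat \<Rightarrow> nat) set"
  assumes pfa: "PFA TYPE(real set set set set)"
    and sym: "\<And>x y. K x y \<Longrightarrow> K y x"
    and open_K: "\<And>x y. K x y \<Longrightarrow> \<exists>n. \<forall>w. (\<forall>i<n. w i = x i) \<longrightarrow> K w y"
    and irrefl: "\<And>x. x \<in> Z \<Longrightarrow> \<not> K x x"
    and large: "\<And>H :: nat \<Rightarrow> (nat \<Rightarrow> nat) set. Z \<subseteq> (\<Union>k. H k) \<Longrightarrow> \<exists>k. \<exists>x\<in>H k. \<exists>y\<in>H k. K x y"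
  shows "\<exists>S\<subseteq>Z. uncountable S \<and> |S| \<le>o cardSuc natLeq \<and> (\<forall>x\<in>S. \<forall>y\<in>S. x \<noteq> y \<longrightarrow> K x y)"
proof -
  obtain \<Lambda> :: "nat set set" where \<Lambda>: "|\<Lambda>| \<le>o cardSuc natLeq" "uncountable \<Lambda>"
    using ex_aleph1_set by blast
  \<comment> \<open>Points carry labels, so that genericity can be asked to meet each of \<open>\<aleph>\<^sub>1\<close> labels; one of the
    countably many cliques obtained then uses uncountably many labels.\<close>
  define K' where "K' x y = K (fst x) (fst y)" for x y :: "(nat \<Rightarrow> nat) \<times> nat set"
  define b where "b k = {x :: (nat \<Rightarrow> nat) \<times> nat set. \<forall>i<length (from_nat k :: nat list). fst x i = from_nat k ! i}" for k
  have b: "b (to_nat (map f [0..<n])) = {x. \<forall>i<n. fst x i = f i}" for f n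
    by (simp add: b_def)
  interpret open_graph "Z \<times> \<Lambda>" K' b
  proof
    fix x y assume "K' x y"
    then show "K' y x" using sym by (simp add: K'_def)
    obtain n where "\<forall>w. (\<forall>i<n. w i = fst x i) \<longrightarrow> K w (fst y)"
      using open_K[of "fst x" "fst y"] \<open>K' x y\<close> unfolding K'_def by blast
    then show "\<exists>k. x \<in> b k \<and> (\<forall>w\<in>b k. K' w y)"
      by (intro exI[of _ "to_nat (map (fst x) [0..<n])"]) (simp add: b K'_def)
  next
    fix x k l assume x: "x \<in> b k" "x \<in> b l"
    define n where "n = max (length (from_nat k :: nat list)) (length (from_nat l :: nat list))"
    have "{y. \<forall>i<n. fst y i = fst x i} \<subseteq> b k \<inter> b l"
      using x by (auto simp: b_def n_def)
    then show "\<exists>m. x \<in> b m \<and> b m \<subseteq> b k \<inter> b l"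
      by (intro exI[of _ "to_nat (map (fst x) [0..<n])"]) (simp add: b)
  next
    fix x show "\<exists>k. x \<in> b k"
      by (intro exI[of _ "to_nat ([] :: nat list)"]) (simp add: b_def)
  qed
  have "\<exists>x\<in>Z \<times> \<Lambda>. snd x = l \<and> x \<notin> \<Union>\<C>" if l: "l \<in> \<Lambda>" and \<C>: "countable \<C>" "\<forall>C\<in>\<C>. free C" for l \<C>
  proof -
    \<comment> \<open>The empty set is inserted so that the enumeration makes sense even if
      \<open>\<C>\<close> is empty.\<close>
    define H where "H k = fst ` (from_nat_into (insert {} \<C>) k)" for k
    have "from_nat_into (insert {} \<C>) k \<in> insert {} \<C>" for k by (rule from_nat_into) simp
    then have "free (from_nat_into (insert {} \<C>) k)" for k using \<C>(2) by (metis empty_iff free_def insert_iff)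
    then have "\<not> K x y" if "x \<in> H k" "y \<in> H k" for x y k
      using that unfolding H_def free_def K'_def by blast
    then have "\<not> Z \<subseteq> (\<Union>k. H k)" using large by blast
    then obtain z where z: "z \<in> Z" "z \<notin> (\<Union>k. H k)" by blast
    have "(z, l) \<notin> C" if "C \<in> \<C>" for C
    proof
      assume "(z, l) \<in> C"
      obtain k where "from_nat_into (insert {} \<C>) k = C"
        using from_nat_into_surj[of "insert {} \<C>" C] \<C>(1) \<open>C \<in> \<C>\<close> by auto
      then have "z \<in> H k" using \<open>(z, l) \<in> C\<close> unfolding H_def by force
      then show False using z(2) by blast
    qed
    then show ?thesis using z(1) l by (intro bexI[of _ "(z, l)"]) auto
  qed
  then have "\<exists>x i. \<forall>l\<in>\<Lambda>. x l \<in> Z \<times> \<Lambda> \<and> snd (x l) = l \<and> (\<forall>m\<in>\<Lambda>. l \<noteq> m \<and> i l = (i m :: nat) \<longrightarrow> K' (x l) (x m))"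
    by (rule PFA_clique[OF PFA_cond[OF pfa] \<Lambda>(1)])
  then obtain x i where xi0: "\<forall>l\<in>\<Lambda>. x l \<in> Z \<times> \<Lambda> \<and> snd (x l) = l \<and> (\<forall>m\<in>\<Lambda>. l \<noteq> m \<and> i l = (i m :: nat) \<longrightarrow> K' (x l) (x m))"
    by (elim exE)
  then have xi: "x l \<in> Z \<times> \<Lambda>" if "l \<in> \<Lambda>" for l using that by simp
  have xiK: "K' (x l) (x m)" if "l \<in> \<Lambda>" "m \<in> \<Lambda>" "l \<noteq> m" "i l = i m" for l m
    using bspec[OF xi0 that(1)] that(2,3,4) by simp
  have "\<exists>c. uncountable {l \<in> \<Lambda>. i l = c}"
  proof (rule ccontr)
    assume "\<nexists>c. uncountable {l \<in> \<Lambda>. i l = c}"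
    then have "countable (\<Union>c. {l \<in> \<Lambda>. i l = c})" by (intro countable_UN) auto
    moreover have "\<Lambda> = (\<Union>c. {l \<in> \<Lambda>. i l = c})" by blast
    ultimately show False using \<Lambda>(2) by simp
  qed
  then obtain c where c: "uncountable {l \<in> \<Lambda>. i l = c}" by blast
  define S where "S = (\<lambda>l. fst (x l)) ` {l \<in> \<Lambda>. i l = c}"
  have SZ: "fst (x l) \<in> Z" if "l \<in> \<Lambda>" for l using xi[OF that] by auto
  have SK: "K (fst (x l)) (fst (x m))" if "l \<in> \<Lambda>" "m \<in> \<Lambda>" "l \<noteq> m" "i l = c" "i m = c" for l m
    using xiK[of l m] that unfolding K'_def by simp
  \<comment> \<open>Two labels of the same colour cannot share their point, since it would then be
    related to itself. Hence uncountably many labels give uncountably many points.\<close>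
  have "inj_on (\<lambda>l. fst (x l)) {l \<in> \<Lambda>. i l = c}"
    using SK irrefl SZ by (intro inj_onI) (metis (mono_tags, lifting) mem_Collect_eq)
  then have "uncountable S" unfolding S_def using c countable_image_inj_on by blast
  moreover have "|S| \<le>o cardSuc natLeq"
  proof -
    have "|S| \<le>o |{l \<in> \<Lambda>. i l = c}|" unfolding S_def by (rule card_of_image)
    moreover have "|{l \<in> \<Lambda>. i l = c}| \<le>o |\<Lambda>|" by (rule card_of_mono1) blast
    ultimately show ?thesis using \<Lambda>(1) ordLeq_transitive by blast
  qed
  moreover have "S \<subseteq> Z" unfolding S_def using SZ by auto
  moreover have "\<forall>x\<in>S. \<forall>y\<in>S. x \<noteq> y \<longrightarrow> K x y" unfolding S_def using SK by auto
  ultimately show ?thesis by blast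
qed

section \<open>Selections from covers of \<open>\<gamma>\<close>-spaces\<close>

text \<open>A finite set is handled by all but finitely many indices of \<open>B\<close>, so the
  families together give an \<omega>-cover. A \<gamma>-cover inside it yields the selection once its
  members are known to use infinitely many indices. For a finite space, sets containing the whole
  space are available from some index on.\<close>

lemma gamma_selection:
  fixes B :: "nat set"
  assumes gamma: "gamma_space X" and t1: "t1_space X" and B: "infinite B"
    and op: "\<And>c U. c \<in> B \<Longrightarrow> U \<in> \<V> c \<Longrightarrow> openin X U"
    and cov: "\<And>c F. c \<in> B \<Longrightarrow> finite F \<Longrightarrow> F \<subseteq> topspace X \<Longrightarrow> card F \<le> c \<Longrightarrow> \<exists>U\<in>\<V> c. F \<subseteq> U"
  shows "\<exists>B' U. B' \<subseteq> B \<and> infinite B' \<and> (\<forall>c\<in>B'. U c \<in> \<V> c) \<and> (\<forall>x\<in>topspace X. finite {c\<in>B'. x \<notin> U c})"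
proof (cases "finite (topspace X)")
  case True
  define B' where "B' = {c\<in>B. card (topspace X) \<le> c}"
  have "B \<subseteq> B' \<union> {..<card (topspace X)}" by (auto simp: B'_def)
  then have "infinite B'" using B by (metis finite_Un finite_lessThan finite_subset)
  moreover have "\<forall>c\<in>B'. \<exists>U. U \<in> \<V> c \<and> topspace X \<subseteq> U"
    using cov[OF _ True order_refl] unfolding B'_def by blast
  then obtain U where U: "\<And>c. c \<in> B' \<Longrightarrow> U c \<in> \<V> c \<and> topspace X \<subseteq> U c" by metis
  moreover have "finite {c\<in>B'. x \<notin> U c}" if "x \<in> topspace X" for x
  proof -
    have "{c\<in>B'. x \<notin> U c} = {}" using U that by blast
    then show ?thesis by (simp only: finite.emptyI)
  qed
  moreover have "B' \<subseteq> B" by (auto simp: B'_def)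
  ultimately show ?thesis by (intro exI[of _ B'] exI[of _ U]) simp
next
  case False
  then obtain y :: "nat \<Rightarrow> 'a" where y: "inj y" "range y \<subseteq> topspace X"
    using infinite_countable_subset by blast
  \<comment> \<open>Removing \<open>y c\<close> keeps any infinite part of a \<open>\<gamma>\<close>-cover from using one index infinitely often.\<close>
  define \<W> where "\<W> = {U - {y c} |c U. c \<in> B \<and> U \<in> \<V> c}"
  have "\<exists>W\<in>\<W>. F \<subseteq> W" if F: "finite F" "F \<subseteq> topspace X" for F
  proof -
    have "finite (y -` F \<union> {..<card F})" using F(1) y(1) by (simp add: finite_vimageI)
    then have "\<not> B \<subseteq> y -` F \<union> {..<card F}" using B finite_subset by metis
    then obtain c where c: "c \<in> B" "c \<notin> y -` F \<union> {..<card F}" by (meson subsetI)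
    then obtain U where "U \<in> \<V> c" "F \<subseteq> U" using cov[OF c(1) F] by auto
    moreover have "y c \<notin> F" using c(2) by simp
    ultimately show ?thesis using c(1) unfolding \<W>_def by (intro bexI[of _ "U - {y c}"]) auto
  qed
  moreover have "\<forall>W\<in>\<W>. openin X W \<and> \<not> topspace X \<subseteq> W"
  proof
    fix W assume "W \<in> \<W>"
    then obtain c U where c: "c \<in> B" "U \<in> \<V> c" "W = U - {y c}" unfolding \<W>_def by blast
    have "y c \<in> topspace X" using y(2) by blast
    then have "closedin X {y c}" using t1 by (simp add: closedin_t1_singleton)
    then show "openin X W \<and> \<not> topspace X \<subseteq> W"
      using op[OF c(1,2)] \<open>y c \<in> topspace X\<close> unfolding c(3) by (auto intro: openin_diff)
  qed
  moreover have "\<Union>\<W> = topspace X"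
  proof
    show "\<Union>\<W> \<subseteq> topspace X" using op openin_subset unfolding \<W>_def by fastforce
    show "topspace X \<subseteq> \<Union>\<W>"
    proof
      fix x assume "x \<in> topspace X"
      then show "x \<in> \<Union>\<W>" using calculation(1)[of "{x}"] by auto
    qed
  qed
  ultimately have "\<W> \<in> Omega_covers X"
    unfolding Omega_covers_def open_cover_of_def cover_of_def by simp
  then obtain \<G> where \<G>: "\<G> \<in> Gamma_covers X" "\<G> \<subseteq> \<W>"
    using gamma unfolding gamma_space_def by blast
  have inf: "infinite \<G>" and fin: "\<And>x. x \<in> topspace X \<Longrightarrow> finite {U\<in>\<G>. x \<notin> U}"
    using \<G>(1) unfolding Gamma_covers_def by auto
  have "\<forall>G\<in>\<G>. \<exists>c. \<exists>U. c \<in> B \<and> U \<in> \<V> c \<and> G = U - {y c}" using \<G>(2) unfolding \<W>_def by blast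
  then obtain k u where ku: "\<And>G. G \<in> \<G> \<Longrightarrow> k G \<in> B \<and> u G \<in> \<V> (k G) \<and> G = u G - {y (k G)}" by metis
  define B' where "B' = k ` \<G>"
  have "finite {G\<in>\<G>. k G = c}" for c
  proof (rule finite_subset)
    show "{G\<in>\<G>. k G = c} \<subseteq> {G\<in>\<G>. y c \<notin> G}" using ku by blast
    show "finite {G\<in>\<G>. y c \<notin> G}" using fin y(2) by blast
  qed
  then have "infinite B'" unfolding B'_def
    using inf pigeonhole_infinite[of \<G> k] by blast
  have "\<forall>c\<in>B'. \<exists>G. G \<in> \<G> \<and> k G = c" unfolding B'_def by blast
  then obtain g where g: "\<And>c. c \<in> B' \<Longrightarrow> g c \<in> \<G> \<and> k (g c) = c" by metis
  have "finite {c\<in>B'. x \<notin> u (g c)}" if "x \<in> topspace X" for x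
  proof (rule finite_subset)
    have "c \<in> k ` {U\<in>\<G>. x \<notin> U}" if "c \<in> B'" "x \<notin> u (g c)" for c
    proof -
      have "x \<notin> g c" using ku[of "g c"] g[OF that(1)] that(2) by blast
      then show ?thesis using g[OF that(1)] by (metis (mono_tags, lifting) image_eqI mem_Collect_eq)
    qed
    then show "{c\<in>B'. x \<notin> u (g c)} \<subseteq> k ` {U\<in>\<G>. x \<notin> U}" by blast
    show "finite (k ` {U\<in>\<G>. x \<notin> U})" using fin[OF that] by simp
  qed
  moreover have "\<forall>c\<in>B'. u (g c) \<in> \<V> c" using g ku by metis
  moreover have "B' \<subseteq> B" unfolding B'_def using ku by blast
  ultimately show ?thesis using \<open>infinite B'\<close> by (intro exI[of _ B'] exI[of _ "\<lambda>c. u (g c)"]) simp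
qed

lemma uniform_on_finite:
  fixes Q :: "'y \<Rightarrow> nat \<Rightarrow> real \<Rightarrow> bool"
  assumes "finite Y" and ex: "\<And>y. y \<in> Y \<Longrightarrow> \<exists>e. \<exists>r>0. Q y e r"
    and mono: "\<And>y e e' r r'. Q y e r \<Longrightarrow> e \<le> e' \<Longrightarrow> r' \<le> r \<Longrightarrow> Q y e' r'"
  shows "\<exists>e. \<exists>r>0. \<forall>y\<in>Y. Q y e r"
  using assms(1,2)
proof (induction Y)
  case empty
  then show ?case by (auto intro: exI[of _ 1])
next
  case (insert y Y)
  then obtain e r where er: "r > 0" "\<forall>y\<in>Y. Q y e r" by auto
  obtain e' r' where "r' > 0" "Q y e' r'" using insert.prems[of y] by auto
  then show ?case using er mono
    by (intro exI[of _ "max e e'"] exI[of _ "min r r'"]) (auto intro: mono)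
qed

section \<open>A finite game on a product\<close>

text \<open>The head of the list belongs to the latest move, which suits the recursion;
  \<open>play\<close> restores the chronological order. \<open>N i F r\<close> is a box in
  coordinate \<open>i\<close> that contains the answer \<open>F\<close> and stays within distance
  \<open>r\<close> of it.\<close>

primrec game_play :: "(nat \<Rightarrow> 'a set \<Rightarrow> real \<Rightarrow> nat) \<Rightarrow> (nat list \<Rightarrow> 'a set) \<Rightarrow> (nat \<Rightarrow> real) \<Rightarrow> nat list \<Rightarrow> nat list" where
  "game_play N \<phi> \<epsilon> [] = []"
| "game_play N \<phi> \<epsilon> (t # s) = game_play N \<phi> \<epsilon> s @ [N (length s) (\<phi> (game_play N \<phi> \<epsilon> s)) (\<epsilon> t)]"

abbreviation "play N \<phi> \<epsilon> s \<equiv> game_play N \<phi> \<epsilon> (rev s)"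

lemma length_game_play [simp]: "length (game_play N \<phi> \<epsilon> s) = length s"
  by (induction s) auto

lemma game_play_cong: "(\<And>t. t \<in> set s \<Longrightarrow> \<epsilon> t = \<delta> t) \<Longrightarrow> game_play N \<phi> \<epsilon> s = game_play N \<phi> \<delta> s"
  by (induction s) auto

lemma take_play: "take i (play N \<phi> \<epsilon> s) = play N \<phi> \<epsilon> (take i s)"
proof (induction s rule: rev_induct)
  case (snoc t s)
  then show ?case by (cases "i \<le> length s") auto
qed simp

lemma nth_play: "i < length s \<Longrightarrow> play N \<phi> \<epsilon> s ! i = N i (\<phi> (play N \<phi> \<epsilon> (take i s))) (\<epsilon> (s ! i))"
proof (induction s rule: rev_induct)
  case (snoc t s)
  then show ?case by (cases "i = length s") (auto simp: nth_append)
qed simp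

text \<open>
  Consider the plays against \<open>\<phi>\<close> whose \<open>i\<close>-th move has radius \<open>\<epsilon> (s ! i)\<close>, for increasing
  lists \<open>s\<close> of length \<open>n\<close>, together with the single play \<open>W\<close> all of whose radii are the much
  smaller \<open>\<epsilon> T\<close>.  Were every pair bad, each \<open>s\<close> would give a common point \<open>x s\<close> outside \<open>V e\<close>,
  near a tuple \<open>p s\<close> of answers in \<open>W\<close>.  Ramsey's theorem makes \<open>p s\<close> constant on the
  increasing lists from a set of size \<open>2 * n\<close>.  Exchanging lists one coordinate at a time,
  that tuple is then near to answers known before stage \<open>m\<close>, which contradicts the choice
  of \<open>\<epsilon> m\<close>.
\<close>

lemma two_plays:
  fixes \<phi> :: "nat list \<Rightarrow> 'a set" and V :: "nat \<Rightarrow> (nat \<Rightarrow> 'a) set"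
  assumes metric: "\<And>i. i < n \<Longrightarrow> Metric_space (M i) (d i)"
    and base: "\<And>i F r. i < n \<Longrightarrow> finite F \<Longrightarrow> F \<subseteq> M i \<Longrightarrow> r > 0 \<Longrightarrow>
        \<exists>m. F \<subseteq> b i m \<and> (\<forall>x\<in>b i m. x \<in> M i \<and> (\<exists>y\<in>F. d i y x < r))"
    and mono: "\<And>e e'. e \<le> e' \<Longrightarrow> V e \<subseteq> V e'"
    and cov: "\<And>x. (\<forall>i<n. x i \<in> M i) \<Longrightarrow> \<exists>e. \<exists>r>0. \<forall>y. (\<forall>i<n. y i \<in> M i \<and> d i (x i) (y i) < r) \<longrightarrow> y \<in> V e"
    and \<phi>: "\<And>ms. length ms < n \<Longrightarrow> finite (\<phi> ms) \<and> \<phi> ms \<subseteq> M (length ms) \<and> card (\<phi> ms) \<le> c"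
  shows "\<exists>ms ms' e. length ms = n \<and> length ms' = n \<and>
      (\<forall>i<n. \<phi> (take i ms) \<subseteq> b i (ms ! i)) \<and> (\<forall>i<n. \<phi> (take i ms') \<subseteq> b i (ms' ! i)) \<and>
      (\<forall>x. (\<forall>i<n. x i \<in> b i (ms ! i) \<inter> b i (ms' ! i)) \<longrightarrow> x \<in> V e)" (is ?goal)
proof (cases "n = 0")
  case True
  then show ?thesis using cov by auto
next
  case False
  define N where "N i F r = (SOME m. F \<subseteq> b i m \<and> (\<forall>x\<in>b i m. x \<in> M i \<and> (\<exists>y\<in>F. d i y x < r)))" for i F r
  have N: "F \<subseteq> b i (N i F r)" "\<forall>x\<in>b i (N i F r). x \<in> M i \<and> (\<exists>y\<in>F. d i y x < r)"
    if "i < n" "finite F" "F \<subseteq> M i" "r > 0" for i F r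
    using someI_ex[OF base[OF that]] unfolding N_def by blast+
  define P where "P \<epsilon> s = play N \<phi> \<epsilon> s" for \<epsilon> s
  have lenP [simp]: "length (P \<epsilon> s) = length s" for \<epsilon> s by (simp add: P_def)
  have \<phi>P: "finite (\<phi> (P \<epsilon> s))" "\<phi> (P \<epsilon> s) \<subseteq> M (length s)" "card (\<phi> (P \<epsilon> s)) \<le> c" if "length s < n" for \<epsilon> s
    using \<phi>[of "P \<epsilon> s"] that by simp_all
  have nthP: "P \<epsilon> s ! i = N i (\<phi> (P \<epsilon> (take i s))) (\<epsilon> (s ! i))" if "i < length s" for \<epsilon> s i
    unfolding P_def using nth_play[OF that] .
  have takeP: "take i (P \<epsilon> s) = P \<epsilon> (take i s)" for \<epsilon> s i
    unfolding P_def by (rule take_play)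
  have near: "x \<in> M i \<and> (\<exists>y\<in>\<phi> (P \<epsilon> (take i s)). d i y x < \<epsilon> (s ! i))"
    if s: "length s = n" "i < n" "\<epsilon> (s ! i) > 0" and x: "x \<in> b i (P \<epsilon> s ! i)" for x \<epsilon> s i
  proof -
    have l: "length (take i s) = i" using s by simp
    show ?thesis
      using N(2)[OF s(2) \<phi>P(1)[of "take i s"] _ s(3)] \<phi>P(2)[of "take i s"] s(2) x nthP[of i s \<epsilon>] s(1)
      unfolding l by simp
  qed
  have legal: "\<phi> (take i (P \<epsilon> s)) \<subseteq> b i (P \<epsilon> s ! i)"
    if s: "length s = n" "i < n" "\<epsilon> (s ! i) > 0" for \<epsilon> s i
  proof -
    have l: "length (take i s) = i" using s by simp
    show ?thesis
      using N(1)[OF s(2) \<phi>P(1)[of "take i s"] _ s(3)] \<phi>P(2)[of "take i s"] s(2) nthP[of i s \<epsilon>] s(1)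
      unfolding l takeP by simp
  qed
  \<comment> \<open>All answers in coordinate \<open>i\<close> to plays with radii of index below
    \<open>m\<close>. There are finitely many and they depend only on \<epsilon> below
    \<open>m\<close>, so \<open>\<epsilon> m\<close> can be chosen recursively against them.\<close>
  define K where "K \<epsilon> m i = (\<Union>s\<in>{s. set s \<subseteq> {..<m} \<and> length s = i}. \<phi> (P \<epsilon> s))" for \<epsilon> and m i :: nat
  have K_fin: "finite (K \<epsilon> m i)" "K \<epsilon> m i \<subseteq> M i" if "i < n" for \<epsilon> m i
  proof -
    show "finite (K \<epsilon> m i)"
      unfolding K_def using \<phi>P(1) that by (intro finite_UN_I) (auto simp: finite_lists_length_eq)
    show "K \<epsilon> m i \<subseteq> M i"
      unfolding K_def
    proof (rule UN_least)
      show "\<phi> (P \<epsilon> s) \<subseteq> M i" if "s \<in> {s. set s \<subseteq> {..<m} \<and> length s = i}" for s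
        using \<phi>P(2)[of s \<epsilon>] that \<open>i < n\<close> by simp
    qed
  qed
  have K_cong: "K \<epsilon> m i = K \<delta> m i" if "\<And>k. k < m \<Longrightarrow> \<epsilon> k = \<delta> k" for \<epsilon> \<delta> m i
  proof -
    have "P \<epsilon> s = P \<delta> s" if "set s \<subseteq> {..<m}" for s
      unfolding P_def using that \<open>\<And>k. k < m \<Longrightarrow> \<epsilon> k = \<delta> k\<close> by (intro game_play_cong) auto
    then show ?thesis unfolding K_def by (intro SUP_cong) auto
  qed
  \<comment> \<open>The factor 3 pays for a chain of three distances below: from a known answer to
    one bad point, from there to the common tuple, and from the tuple to another bad point.\<close>
  define Q where "Q y e r \<longleftrightarrow> (\<forall>z. (\<forall>i<n. z i \<in> M i \<and> d i (y i) (z i) < 3 * r) \<longrightarrow> z \<in> V e)" for y e r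
  have Qmono: "Q y e' r'" if "Q y e r" "e \<le> e'" "r' \<le> r" for y e e' r r'
    unfolding Q_def
  proof (intro allI impI)
    fix z assume z: "\<forall>i<n. z i \<in> M i \<and> d i (y i) (z i) < 3 * r'"
    have "\<forall>i<n. z i \<in> M i \<and> d i (y i) (z i) < 3 * r"
    proof (intro allI impI)
      fix i assume "i < n"
      then show "z i \<in> M i \<and> d i (y i) (z i) < 3 * r" using z that(3) by force
    qed
    then have "z \<in> V e" using that(1) unfolding Q_def by blast
    then show "z \<in> V e'" using mono[OF that(2)] by blast
  qed
  define R where "R \<epsilon> m r \<longleftrightarrow> r > 0 \<and> (\<forall>k<m. r \<le> \<epsilon> k) \<and> (\<exists>e. \<forall>y\<in>PiE {..<n} (K \<epsilon> m). Q y e r)"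
    for \<epsilon> and m :: nat and r
  have "\<exists>\<epsilon>. \<forall>m. R \<epsilon> m (\<epsilon> m)"
  proof (rule dependent_wellorder_choice)
    fix r and \<epsilon> \<delta> :: "nat \<Rightarrow> real" and m :: nat assume eq: "\<And>k. k < m \<Longrightarrow> \<epsilon> k = \<delta> k"
    then have "K \<epsilon> m = K \<delta> m" using K_cong[of m \<epsilon> \<delta>] by (intro ext) blast
    then show "R \<epsilon> m r = R \<delta> m r" using eq unfolding R_def by simp
  next
    fix m and \<epsilon> :: "nat \<Rightarrow> real" assume "\<And>k. k < m \<Longrightarrow> R \<epsilon> k (\<epsilon> k)"
    then have pos: "\<epsilon> k > 0" if "k < m" for k using that unfolding R_def by simp
    have fin: "finite (PiE {..<n} (K \<epsilon> m))" using K_fin by (intro finite_PiE) auto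
    have "\<exists>e. \<exists>r>0. Q y e r" if y: "y \<in> PiE {..<n} (K \<epsilon> m)" for y
    proof -
      have yM: "y i \<in> M i" if "i < n" for i
        using PiE_mem[OF y, of i] K_fin(2)[OF that, of \<epsilon> m] that by auto
      have "\<exists>e. \<exists>r>0. \<forall>z. (\<forall>i<n. z i \<in> M i \<and> d i (y i) (z i) < r) \<longrightarrow> z \<in> V e"
        by (rule cov) (simp add: yM)
      then obtain e r where "r > 0" "\<forall>z. (\<forall>i<n. z i \<in> M i \<and> d i (y i) (z i) < r) \<longrightarrow> z \<in> V e"
        by (elim exE conjE)
      then show ?thesis unfolding Q_def by (intro exI[of _ e] exI[of _ "r / 3"]) simp
    qed
    then have "\<exists>e. \<exists>r>0. \<forall>y\<in>PiE {..<n} (K \<epsilon> m). Q y e r"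
      by (rule uniform_on_finite[OF fin]) (auto intro: Qmono)
    then obtain e r where er: "r > 0" "\<forall>y\<in>PiE {..<n} (K \<epsilon> m). Q y e r" by (elim exE conjE)
    define r' where "r' = Min (insert r (\<epsilon> ` {..<m}))"
    have r': "r' > 0" "r' \<le> r" "\<forall>k<m. r' \<le> \<epsilon> k" unfolding r'_def using er(1) pos by auto
    have "\<forall>y\<in>PiE {..<n} (K \<epsilon> m). Q y e r'" using er(2) Qmono[OF _ order_refl r'(2)] by blast
    then show "\<exists>r. R \<epsilon> m r" using r' unfolding R_def by (intro exI[of _ r']) blast
  qed
  then obtain \<epsilon> where \<epsilon>: "\<And>m. R \<epsilon> m (\<epsilon> m)" by blast
  have pos: "\<epsilon> m > 0" for m using \<epsilon>[of m] by (simp add: R_def)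
  have anti: "k < m \<Longrightarrow> \<epsilon> m \<le> \<epsilon> k" for k m using \<epsilon>[of m] by (simp add: R_def)
  have "\<exists>e. \<forall>y\<in>PiE {..<n} (K \<epsilon> m). Q y e (\<epsilon> m)" for m using \<epsilon>[of m] by (simp add: R_def)
  then obtain E where E: "\<And>m y. y \<in> PiE {..<n} (K \<epsilon> m) \<Longrightarrow> Q y (E m) (\<epsilon> m)"
    by metis
  \<comment> \<open>The colours are the possible tuples of answers in \<open>W\<close>: one point
    from each of \<open>n\<close> sets with at most \<open>c\<close> elements. Homogeneous sets of
    size \<open>2 * n\<close> leave room for the exchange of lists.\<close>
  obtain T :: nat where T: "partn_lst {..<T} (replicate (c ^ n) (2 * n)) n" using ramsey_full[of "replicate (c ^ n) (2 * n)" n] by blast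
  define W where "W = P \<epsilon> (replicate n T)"
  \<comment> \<open>The sum is merely a common upper bound for the numbers \<open>E m\<close>, so
    that one \<open>e\<close> serves every list below \<open>T\<close>.\<close>
  define e where "e = (\<Sum>m\<le>T. E m)"
  have Ee: "E m \<le> e" if "m \<le> T" for m unfolding e_def using that by (intro member_le_sum) auto
  show ?thesis
  proof (rule ccontr)
    assume no: "\<not> ?thesis"
    have lW: "length W = n" by (simp add: W_def)
    have W: "\<forall>i<n. \<phi> (take i W) \<subseteq> b i (W ! i)"
    proof (intro allI impI)
      show "\<phi> (take i W) \<subseteq> b i (W ! i)" if "i < n" for i
        unfolding W_def by (rule legal) (use that pos in simp_all)
    qed
    have "\<exists>x. (\<forall>i<n. x i \<in> b i (P \<epsilon> s ! i) \<inter> b i (W ! i)) \<and> x \<notin> V e" if s: "length s = n" for s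
    proof (rule ccontr)
      assume "\<nexists>x. (\<forall>i<n. x i \<in> b i (P \<epsilon> s ! i) \<inter> b i (W ! i)) \<and> x \<notin> V e"
      then have "\<forall>x. (\<forall>i<n. x i \<in> b i (P \<epsilon> s ! i) \<inter> b i (W ! i)) \<longrightarrow> x \<in> V e" by blast
      moreover have "\<forall>i<n. \<phi> (take i (P \<epsilon> s)) \<subseteq> b i (P \<epsilon> s ! i)" using legal[OF s] pos by blast
      ultimately have ?goal
        using W lW s by (intro exI[of _ "P \<epsilon> s"] exI[of _ W] exI[of _ e] conjI) simp_all
      then show False using no by simp
    qed
    then obtain x where x: "\<And>s. length s = n \<Longrightarrow> (\<forall>i<n. x s i \<in> b i (P \<epsilon> s ! i) \<inter> b i (W ! i)) \<and> x s \<notin> V e"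
      by metis
    define F where "F i = \<phi> (P \<epsilon> (replicate i T))" for i
    have xF: "x s i \<in> M i \<and> (\<exists>y\<in>F i. d i y (x s i) < \<epsilon> T)" if s: "length s = n" "i < n" for s i
    proof -
      have "x s i \<in> b i (P \<epsilon> (replicate n T) ! i)" using x[OF s(1)] s(2) unfolding W_def by blast
      then show ?thesis
        using near[of "replicate n T" i \<epsilon> "x s i"] s pos unfolding F_def by (simp add: min_def)
    qed
    then have xM: "x s i \<in> M i" if "length s = n" "i < n" for s i using that by blast
    have "\<exists>y. length s = n \<longrightarrow> i < n \<longrightarrow> y \<in> F i \<and> d i y (x s i) < \<epsilon> T" for s i using xF by blast
    then obtain p where p: "\<And>s i. length s = n \<Longrightarrow> i < n \<Longrightarrow> p s i \<in> F i \<and> d i (p s i) (x s i) < \<epsilon> T" by metis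
    have finF: "finite (F i)" "card (F i) \<le> c" "F i \<subseteq> M i" if "i < n" for i
      using \<phi>P[of "replicate i T" \<epsilon>] that unfolding F_def by simp_all
    have "finite (PiE {..<n} F)" using finF by (intro finite_PiE) auto
    moreover have "card (PiE {..<n} F) \<le> card {..<c ^ n}"
      using prod_mono[of "{..<n}" "\<lambda>i. card (F i)" "\<lambda>_. c"] finF by (simp add: card_PiE)
    ultimately obtain g :: "_ \<Rightarrow> nat" where g: "inj_on g (PiE {..<n} F)" "g ` PiE {..<n} F \<subseteq> {..<c ^ n}"
      using inj_on_iff_card_le[of "PiE {..<n} F" "{..<c ^ n}"] by blast
    define l where "l S = sorted_list_of_set S" for S :: "nat set"
    have len: "length (l S) = n" if "S \<in> nsets {..<T} n" for S
      using that unfolding l_def nsets_def by simp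
    have pE: "restrict (p (l S)) {..<n} \<in> PiE {..<n} F" if "S \<in> nsets {..<T} n" for S
      using p[OF len[OF that]] by auto
    define col where "col S = g (restrict (p (l S)) {..<n})" for S
    have "col \<in> nsets {..<T} n \<rightarrow> {..<length (replicate (c ^ n) (2 * n))}"
    proof (rule funcsetI)
      show "col S \<in> {..<length (replicate (c ^ n) (2 * n))}" if "S \<in> nsets {..<T} n" for S
        using g(2) pE[OF that] unfolding col_def length_replicate by blast
    qed
    then obtain j where j: "j < c ^ n" and mo: "monochromatic {..<T} (2 * n) n col j"
      using T unfolding partn_lst_def by fastforce
    then obtain H where H: "H \<in> nsets {..<T} (2 * n)" and colH: "col ` nsets H n \<subseteq> {j}"
      unfolding monochromatic_def by blast
    define h where "h = sorted_list_of_set H"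
    have h: "length h = 2 * n" "sorted h" "distinct h" "set h = H" "H \<subseteq> {..<T}"
      using H unfolding h_def nsets_def by auto
    have lH: "l (set s) = s" "set s \<in> nsets H n" "set s \<in> nsets {..<T} n"
      if "sorted s" "distinct s" "set s \<subseteq> H" "length s = n" for s
      using that h(5) unfolding l_def nsets_def
      by (auto simp: sorted_list_of_set.idem_if_sorted_distinct distinct_card)
    have same: "p s i = p s' i" if s: "sorted s" "distinct s" "set s \<subseteq> H" "length s = n"
      "sorted s'" "distinct s'" "set s' \<subseteq> H" "length s' = n" and i: "i < n" for s s' i
    proof -
      have "col (set s) = col (set s')" using colH lH(2)[OF s(1-4)] lH(2)[OF s(5-8)] by blast
      then have "restrict (p s) {..<n} = restrict (p s') {..<n}"
        using inj_onD[OF g(1) _ pE pE] lH[OF s(1-4)] lH[OF s(5-8)] unfolding col_def by metis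
      then show ?thesis using i by (metis lessThan_iff restrict_apply')
    qed
    define m where "m = h ! n"
    have "m \<in> H" unfolding m_def using h False by (metis nth_mem mult_2 less_add_same_cancel1 neq0_conv)
    then have mT: "m < T" using h(5) by auto
    \<comment> \<open>The list \<open>s i\<close> keeps the first \<open>i\<close> elements of
      \<open>h\<close> and then jumps to \<open>m = h ! n\<close>. Thus its entry at position
      \<open>i\<close> is \<open>m\<close>, while all earlier entries are below
      \<open>m\<close>.\<close>
    define s where "s i = take i h @ take (n - i) (drop n h)" for i
    have s: "sorted (s i)" "distinct (s i)" "set (s i) \<subseteq> H" "length (s i) = n" "s i ! i = m" "take i (s i) = take i h"
      if "i < n" for i
    proof -
      have sub: "set (take i h) \<subseteq> set (take n h)" "set (take (n - i) (drop n h)) \<subseteq> set (drop n h)"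
        using that by (simp_all add: set_take_subset_set_take set_take_subset)
      have 1: "sorted (take n h @ drop n h)" "distinct (take n h @ drop n h)" using h by simp_all
      show "sorted (s i)" unfolding s_def sorted_append
        using 1(1) sub h(2) unfolding sorted_append by (auto intro: sorted_wrt_take sorted_wrt_drop)
      show "distinct (s i)" unfolding s_def distinct_append
        using 1(2) sub h(3) unfolding distinct_append by auto
      show "set (s i) \<subseteq> H" unfolding s_def h(4)[symmetric]
        using set_take_subset set_drop_subset sub by fastforce
      show "length (s i) = n" "take i (s i) = take i h" using that h(1) unfolding s_def by simp_all
      show "s i ! i = m" unfolding s_def m_def using that h(1) by (simp add: nth_append)
    qed
    have below: "set (take i h) \<subseteq> {..<m}" if "i < n" for i
    proof
      fix a assume "a \<in> set (take i h)"
      then obtain k where k: "k < i" "a = h ! k" using h(1) that by (auto simp: in_set_conv_nth)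
      then have "h ! k \<le> h ! n" "h ! k \<noteq> h ! n"
        using sorted_nth_mono[OF h(2), of k n] h(1,3) that by (auto simp: nth_eq_iff_index_eq)
      then show "a \<in> {..<m}" using k by (simp add: m_def)
    qed
    have 0: "0 < n" using False by simp
    \<comment> \<open>Move \<open>i\<close> of the play for \<open>s i\<close> has radius
      \<open>\<epsilon> m\<close> around an answer in \<open>K \<epsilon> m i\<close>. By
      homogeneity the bad points of \<open>s i\<close> and \<open>s 0\<close> are, in coordinate
      \<open>i\<close>, within \<open>\<epsilon> T\<close> of the same point, and
      \<open>\<epsilon> T\<close> is at most \<open>\<epsilon> m\<close>.\<close>
    have "\<exists>y\<in>K \<epsilon> m i. d i y (x (s 0) i) < 3 * \<epsilon> m" if i: "i < n" for i
    proof -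
      interpret Metric_space "M i" "d i" by (rule metric[OF i])
      have "x (s i) i \<in> b i (P \<epsilon> (s i) ! i)" using x[OF s(4)[OF i]] i by blast
      then obtain y where y: "y \<in> \<phi> (P \<epsilon> (take i h))" "d i y (x (s i) i) < \<epsilon> m"
        using near[OF s(4)[OF i] i, of \<epsilon>] pos s(5,6)[OF i] by auto
      have yK: "y \<in> K \<epsilon> m i" unfolding K_def using y(1) below[OF i] h(1) i by (intro UN_I[of "take i h"]) auto
      let ?p = "p (s 0) i"
      have 1: "d i ?p (x (s i) i) < \<epsilon> T" "d i ?p (x (s 0) i) < \<epsilon> T" "?p \<in> M i"
        using p[OF s(4)[OF i] i] p[OF s(4)[OF 0] i] same[OF s(1-4)[OF i] s(1-4)[OF 0] i] finF(3)[OF i] by auto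
      have 2: "x (s i) i \<in> M i" "x (s 0) i \<in> M i" using xM s(4) i 0 by blast+
      have "y \<in> M i" using yK K_fin(2)[OF i] by blast
      then have "d i y (x (s 0) i) \<le> d i y (x (s i) i) + (d i (x (s i) i) ?p + d i ?p (x (s 0) i))"
        using triangle[of y "x (s i) i" "x (s 0) i"] triangle[of "x (s i) i" ?p "x (s 0) i"] 1(3) 2 by linarith
      then have "d i y (x (s 0) i) < 3 * \<epsilon> m"
        using y(2) 1(1,2) anti[OF mT] commute[of "x (s i) i" ?p] by linarith
      then show ?thesis using yK by blast
    qed
    then obtain y where y: "\<And>i. i < n \<Longrightarrow> y i \<in> K \<epsilon> m i \<and> d i (y i) (x (s 0) i) < 3 * \<epsilon> m" by metis
    have "restrict y {..<n} \<in> PiE {..<n} (K \<epsilon> m)" using y by auto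
    then have Q: "Q (restrict y {..<n}) (E m) (\<epsilon> m)" by (rule E)
    have "x (s 0) \<in> V (E m)"
      by (rule Q[unfolded Q_def, rule_format]) (use y xM[OF s(4)[OF 0]] in simp)
    then show False using x[OF s(4)[OF 0]] mono[OF Ee[of m]] mT by (meson less_imp_le subsetD)
  qed
qed

section \<open>The Menger property of finite products\<close>

lemma separable_metric_base:
  assumes "Metric_space M d" and sep: "separable_space (Metric_space.mtopology M d)"
  shows "\<exists>b :: nat \<Rightarrow> 'a set. b 0 = M \<and> (\<forall>m. openin (Metric_space.mtopology M d) (b m)) \<and>
      (\<forall>F r. finite F \<longrightarrow> F \<subseteq> M \<longrightarrow> r > 0 \<longrightarrow> (\<exists>m. F \<subseteq> b m \<and> (\<forall>x\<in>b m. x \<in> M \<and> (\<exists>y\<in>F. d y x < r))))"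
proof -
  interpret Metric_space M d by fact
  obtain C where C: "countable C" "C \<subseteq> M" "mtopology closure_of C = M"
    using sep unfolding separable_space_def by auto
  define q where "q = from_nat_into C"
  define U where "U k = (\<Union>(a, r)\<in>set (from_nat k :: (nat \<times> nat) list). mball (q a) (1 / Suc r))" for k
  define b where "b m = (case m of 0 \<Rightarrow> M | Suc k \<Rightarrow> U k)" for m
  have "openin mtopology (U k)" for k
    unfolding U_def by (rule openin_Union) (auto simp: openin_mball)
  then have "openin mtopology (b m)" for m
    using openin_topspace[of mtopology] by (simp add: b_def split: nat.split)
  moreover have "\<exists>m. F \<subseteq> b m \<and> (\<forall>x\<in>b m. x \<in> M \<and> (\<exists>y\<in>F. d y x < r))"
    if F: "finite F" "F \<subseteq> M" and r: "r > 0" for F r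
  proof -
    obtain R :: nat where R: "1 / Suc R < r / 2" using nat_approx_posE[of "r / 2"] r by auto
    have "\<exists>a. q a \<in> mball y (1 / Suc R)" if y: "y \<in> F" for y
    proof -
      have "y \<in> mtopology closure_of C" using y F(2) C(3) by blast
      moreover have "1 / Suc R > 0" by simp
      ultimately obtain z where "z \<in> C" "z \<in> mball y (1 / Suc R)"
        unfolding metric_closure_of by blast
      then show ?thesis using from_nat_into_surj[OF C(1)] unfolding q_def by metis
    qed
    then obtain A where A: "\<And>y. y \<in> F \<Longrightarrow> q (A y) \<in> mball y (1 / Suc R)" by metis
    obtain ys where ys: "set ys = F" using finite_list[OF F(1)] by blast
    define m where "m = Suc (to_nat (map (\<lambda>y. (A y, R)) ys))"
    have bm: "b m = (\<Union>y\<in>F. mball (q (A y)) (1 / Suc R))"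
      unfolding m_def b_def U_def using ys by auto
    have "F \<subseteq> b m"
      unfolding bm using A by (auto simp: commute simp del: of_nat_Suc)
    moreover have "x \<in> M \<and> (\<exists>y\<in>F. d y x < r)" if "x \<in> b m" for x
    proof -
      obtain y where y: "y \<in> F" "x \<in> mball (q (A y)) (1 / Suc R)" using \<open>x \<in> b m\<close> unfolding bm by blast
      then have "d y x \<le> d y (q (A y)) + d (q (A y)) x" using A[OF y(1)] by (intro triangle) auto
      then have "d y x < r" using A[OF y(1)] y(2) R unfolding in_mball by linarith
      then show ?thesis using y by auto
    qed
    ultimately show ?thesis by blast
  qed
  ultimately show ?thesis by (intro exI[of _ b]) (simp add: b_def)
qed

text \<open>The predicate \<open>G c k\<close> stands for winning positions, one game for each pair
  \<open>k \<le> c\<close>. All games advance by one coordinate at the same time; the next factor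
  then shrinks the index set, which preserves what was achieved in the earlier factors.\<close>

lemma iterated_gamma_selection:
  fixes G :: "nat \<Rightarrow> nat \<Rightarrow> nat list \<Rightarrow> bool" and b :: "nat \<Rightarrow> nat \<Rightarrow> 'a set"
  assumes gamma: "\<And>i. i < n \<Longrightarrow> gamma_space (X i)" and t1: "\<And>i. i < n \<Longrightarrow> t1_space (X i)"
    and b: "\<And>i m. i < n \<Longrightarrow> openin (X i) (b i m)"
    and start: "\<And>c k. G c k []"
    and step: "\<And>c k ms F. length ms < n \<Longrightarrow> G c k ms \<Longrightarrow> finite F \<Longrightarrow> F \<subseteq> topspace (X (length ms)) \<Longrightarrow>
        card F \<le> c \<Longrightarrow> \<exists>m. F \<subseteq> b (length ms) m \<and> G c k (ms @ [m])"
  shows "\<exists>B ms. infinite B \<and> (\<forall>c\<in>B. \<forall>k\<le>c. length (ms c k) = n \<and> G c k (ms c k)) \<and>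
      (\<forall>i<n. \<forall>x\<in>topspace (X i). finite {c\<in>B. \<exists>k\<le>c. x \<notin> b i (ms c k ! i)})"
proof -
  have "\<exists>B ms. infinite B \<and> (\<forall>c\<in>B. \<forall>k\<le>c. length (ms c k) = r \<and> G c k (ms c k)) \<and>
      (\<forall>i<r. \<forall>x\<in>topspace (X i). finite {c\<in>B. \<exists>k\<le>c. x \<notin> b i (ms c k ! i)})" if "r \<le> n" for r
    using that
  proof (induction r)
    case 0
    show ?case using start by (intro exI[of _ UNIV] exI[of _ "\<lambda>_ _. []"]) simp
  next
    case (Suc r)
    then have r: "r < n" by simp
    obtain B ms where B: "infinite B" and ms: "\<And>c k. c \<in> B \<Longrightarrow> k \<le> c \<Longrightarrow> length (ms c k) = r \<and> G c k (ms c k)"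
      and fin: "\<And>i x. i < r \<Longrightarrow> x \<in> topspace (X i) \<Longrightarrow> finite {c\<in>B. \<exists>k\<le>c. x \<notin> b i (ms c k ! i)}"
      using Suc.IH[OF less_imp_le[OF r]] by (elim exE conjE) blast
    \<comment> \<open>For each \<open>c\<close> only finitely many games are open, so the
      intersection of their moves is still an open set, and a point of it lies in all of these
      boxes.\<close>
    define \<V> where "\<V> c = {\<Inter>k\<le>c. b r (m k) |m. \<forall>k\<le>c. G c k (ms c k @ [m k])}" for c
    have "\<exists>B' U. B' \<subseteq> B \<and> infinite B' \<and> (\<forall>c\<in>B'. U c \<in> \<V> c) \<and> (\<forall>x\<in>topspace (X r). finite {c\<in>B'. x \<notin> U c})"
    proof (rule gamma_selection[OF gamma[OF r] t1[OF r] B])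
      fix c U assume "U \<in> \<V> c"
      then obtain m where "U = (\<Inter>k\<le>c. b r (m k))" unfolding \<V>_def by blast
      then show "openin (X r) U" using b[OF r] by (simp only:) (intro openin_Inter; auto)
    next
      fix c F assume c: "c \<in> B" and F: "finite F" "F \<subseteq> topspace (X r)" "card F \<le> c"
      have "\<exists>m. k \<le> c \<longrightarrow> F \<subseteq> b r m \<and> G c k (ms c k @ [m])" for k
        using step[of "ms c k" c k F] ms[OF c, of k] F r by auto
      then obtain m where m: "\<And>k. k \<le> c \<Longrightarrow> F \<subseteq> b r (m k) \<and> G c k (ms c k @ [m k])" by metis
      show "\<exists>U\<in>\<V> c. F \<subseteq> U"
      proof (rule bexI)
        show "F \<subseteq> (\<Inter>k\<le>c. b r (m k))" using m by blast
        show "(\<Inter>k\<le>c. b r (m k)) \<in> \<V> c" unfolding \<V>_def using m by blast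
      qed
    qed
    then obtain B' U where B': "B' \<subseteq> B" "infinite B'" and U: "\<And>c. c \<in> B' \<Longrightarrow> U c \<in> \<V> c"
      and finU: "\<And>x. x \<in> topspace (X r) \<Longrightarrow> finite {c\<in>B'. x \<notin> U c}" by blast
    have "\<exists>m. c \<in> B' \<longrightarrow> U c = (\<Inter>k\<le>c. b r (m k)) \<and> (\<forall>k\<le>c. G c k (ms c k @ [m k]))" for c
      using U[of c] unfolding \<V>_def by blast
    then obtain m where m: "\<And>c. c \<in> B' \<Longrightarrow> U c = (\<Inter>k\<le>c. b r (m c k)) \<and> (\<forall>k\<le>c. G c k (ms c k @ [m c k]))"
      by metis
    define ms' where "ms' c k = ms c k @ [m c k]" for c k
    have old: "ms' c k ! i = ms c k ! i" if "c \<in> B'" "k \<le> c" "i < r" for c k i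
      using ms[of c k] B'(1) that unfolding ms'_def by (auto simp: nth_append)
    have new: "ms' c k ! r = m c k" if "c \<in> B'" "k \<le> c" for c k
      using ms[of c k] B'(1) that unfolding ms'_def by (auto simp: nth_append)
    have "finite {c\<in>B'. \<exists>k\<le>c. x \<notin> b i (ms' c k ! i)}" if "i < Suc r" "x \<in> topspace (X i)" for i x
    proof (cases "i = r")
      case True
      have "{c\<in>B'. \<exists>k\<le>c. x \<notin> b i (ms' c k ! i)} \<subseteq> {c\<in>B'. x \<notin> U c}"
        unfolding True using m new by auto
      then show ?thesis using finU that(2) unfolding True by (meson finite_subset)
    next
      case False
      then have i: "i < r" using that(1) by simp
      have "{c\<in>B'. \<exists>k\<le>c. x \<notin> b i (ms' c k ! i)} \<subseteq> {c\<in>B. \<exists>k\<le>c. x \<notin> b i (ms c k ! i)}"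
        using old[OF _ _ i] B'(1) by auto
      then show ?thesis using fin[OF i that(2)] by (meson finite_subset)
    qed
    moreover have "length (ms' c k) = Suc r \<and> G c k (ms' c k)" if "c \<in> B'" "k \<le> c" for c k
      using ms[of c k] m[OF that(1)] B'(1) that unfolding ms'_def by auto
    ultimately show ?case using B'(2) by (intro exI[of _ B'] exI[of _ ms']) blast
  qed
  then show ?thesis by blast
qed

primrec wins :: "(nat \<Rightarrow> 'a set) \<Rightarrow> (nat \<Rightarrow> nat \<Rightarrow> 'a set) \<Rightarrow> nat \<Rightarrow> (nat list \<Rightarrow> bool) \<Rightarrow> nat \<Rightarrow> nat list \<Rightarrow> bool" where
  "wins M b c goal 0 ms = goal ms"
| "wins M b c goal (Suc r) ms = (\<forall>F. finite F \<longrightarrow> F \<subseteq> M (length ms) \<longrightarrow> card F \<le> c \<longrightarrow>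
     (\<exists>m. F \<subseteq> b (length ms) m \<and> wins M b c goal r (ms @ [m])))"

text \<open>Determinacy of a finite game: at a position that is not winning, some finite set leaves
  only replies that are again not winning. The length of a position tells how many rounds remain, so
  the strategy depends on the position alone.\<close>

lemma not_wins_strategy:
  assumes "\<not> wins M b c goal n []"
  shows "\<exists>\<phi>. (\<forall>ms. length ms < n \<longrightarrow> finite (\<phi> ms) \<and> \<phi> ms \<subseteq> M (length ms) \<and> card (\<phi> ms) \<le> c) \<and>
    (\<forall>ms. length ms = n \<longrightarrow> (\<forall>i<n. \<phi> (take i ms) \<subseteq> b i (ms ! i)) \<longrightarrow> \<not> goal ms)"
proof -
  have "\<exists>F. length ms < n \<longrightarrow> (finite F \<and> F \<subseteq> M (length ms) \<and> card F \<le> c) \<and>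
      (\<not> wins M b c goal (n - length ms) ms \<longrightarrow>
        (\<forall>m. F \<subseteq> b (length ms) m \<longrightarrow> \<not> wins M b c goal (n - Suc (length ms)) (ms @ [m])))" for ms
  proof (cases "length ms < n \<and> \<not> wins M b c goal (n - length ms) ms")
    case True
    then have "n - length ms = Suc (n - Suc (length ms))" by (intro Suc_diff_Suc[symmetric]) (rule conjunct1)
    then have "\<not> wins M b c goal (Suc (n - Suc (length ms))) ms" using True by simp
    then show ?thesis unfolding wins.simps by blast
  qed (auto intro: exI[of _ "{}"])
  then obtain \<phi> where \<phi>: "\<And>ms. length ms < n \<Longrightarrow> finite (\<phi> ms) \<and> \<phi> ms \<subseteq> M (length ms) \<and> card (\<phi> ms) \<le> c"
    and \<phi>': "\<And>ms m. length ms < n \<Longrightarrow> \<not> wins M b c goal (n - length ms) ms \<Longrightarrow> \<phi> ms \<subseteq> b (length ms) m \<Longrightarrow>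
      \<not> wins M b c goal (n - Suc (length ms)) (ms @ [m])"
    by metis
  have "\<not> goal ms" if ms: "length ms = n" "\<forall>i<n. \<phi> (take i ms) \<subseteq> b i (ms ! i)" for ms
  proof -
    have "\<not> wins M b c goal (n - i) (take i ms)" if "i \<le> n" for i
      using that
    proof (induction i)
      case 0
      then show ?case using assms by simp
    next
      case (Suc i)
      then have "\<not> wins M b c goal (n - Suc (length (take i ms))) (take i ms @ [ms ! i])"
        using ms by (intro \<phi>') auto
      then show ?case using Suc.prems ms(1) by (simp add: take_Suc_conv_app_nth min_def)
    qed
    from this[of n] show ?thesis using ms(1) by simp
  qed
  then show ?thesis using \<phi> by blast
qed

theorem PFA_product_menger:
  fixes M :: "nat \<Rightarrow> 'a set" and V :: "nat \<Rightarrow> nat \<Rightarrow> (nat \<Rightarrow> 'a) set"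
  assumes pfa: "PFA TYPE(real set set set set)"
    and metric: "\<And>i. i < n \<Longrightarrow> Metric_space (M i) (d i)"
    and separable: "\<And>i. i < n \<Longrightarrow> separable_space (Metric_space.mtopology (M i) (d i))"
    and gamma: "\<And>i. i < n \<Longrightarrow> gamma_space (Metric_space.mtopology (M i) (d i))"
    and mono: "\<And>j e e'. e \<le> e' \<Longrightarrow> V j e \<subseteq> V j e'"
    and cov: "\<And>j x. (\<forall>i<n. x i \<in> M i) \<Longrightarrow>
        \<exists>e. \<exists>r>0. \<forall>y. (\<forall>i<n. y i \<in> M i \<and> d i (x i) (y i) < r) \<longrightarrow> y \<in> V j e"
  shows "\<exists>h. \<forall>x. (\<forall>i<n. x i \<in> M i) \<longrightarrow> (\<exists>j. x \<in> V j (h j))"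
proof (rule ccontr)
  assume no: "\<nexists>h. \<forall>x. (\<forall>i<n. x i \<in> M i) \<longrightarrow> (\<exists>j. x \<in> V j (h j))"
  have "\<exists>x. (\<forall>i<n. x i \<in> M i) \<and> (\<forall>j. x \<notin> V j (h j))" for h using no by blast
  then obtain X where X: "\<And>h i. i < n \<Longrightarrow> X h i \<in> M i" "\<And>h j. X h \<notin> V j (h j)" by metis
  let ?T = "\<lambda>i. Metric_space.mtopology (M i) (d i)"
  have top: "topspace (?T i) = M i" if "i < n" for i using Metric_space.topspace_mtopology[OF metric[OF that]] .
  define good where "good i b \<longleftrightarrow> b 0 = M i \<and> (\<forall>m. openin (?T i) (b m)) \<and> (\<forall>F r. finite F \<longrightarrow> F \<subseteq> M i \<longrightarrow> r > 0 \<longrightarrow>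
      (\<exists>m. F \<subseteq> b m \<and> (\<forall>x\<in>b m. x \<in> M i \<and> (\<exists>y\<in>F. d i y x < r))))" for i and b :: "nat \<Rightarrow> 'a set"
  have "\<exists>b. good i b" if "i < n" for i
    unfolding good_def by (rule separable_metric_base[OF metric[OF that] separable[OF that]])
  then obtain b where b: "\<And>i. i < n \<Longrightarrow> good i (b i)" by metis
  have b0: "\<And>i. i < n \<Longrightarrow> b i 0 = M i" and b_open: "\<And>i m. i < n \<Longrightarrow> openin (?T i) (b i m)"
    and base: "\<And>i F r. i < n \<Longrightarrow> finite F \<Longrightarrow> F \<subseteq> M i \<Longrightarrow> r > 0 \<Longrightarrow>
      \<exists>m. F \<subseteq> b i m \<and> (\<forall>x\<in>b i m. x \<in> M i \<and> (\<exists>y\<in>F. d i y x < r))"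
    using b unfolding good_def by simp_all
  define box where "box ms = {x. \<forall>i<n. x i \<in> b i (ms ! i)}" for ms
  define D where "D v j = (from_nat (v j) :: nat list \<times> nat)" for v :: "nat \<Rightarrow> nat" and j :: nat
  define inc where "inc j p q \<longleftrightarrow> box (fst p) \<inter> box (fst q) \<subseteq> V j (snd p) \<union> V j (snd q)" for j p q
  define K where "K v w \<longleftrightarrow> (\<exists>j. inc j (D v j) (D w j))" for v w
  \<comment> \<open>\<open>v \<in> Z\<close> codes a sequence of boxes containing almost all of every point, together with a bound
    \<open>snd (D v j)\<close> that does not cover the \<open>j\<close>-th box.\<close>
  define promise where "promise v \<longleftrightarrow> (\<forall>i<n. \<forall>x\<in>M i. finite {j. x \<notin> b i (fst (D v j) ! i)})" for v
  define Z where "Z = {v. promise v \<and> (\<forall>j. \<not> inc j (D v j) (D v j))}"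
  have fin_box: "finite {j. x \<notin> box (fst (D v j))}" if "promise v" "\<And>i. i < n \<Longrightarrow> x i \<in> M i" for v x
  proof -
    have "{j. x \<notin> box (fst (D v j))} = (\<Union>i<n. {j. x i \<notin> b i (fst (D v j) ! i)})" unfolding box_def by blast
    then show ?thesis using that unfolding promise_def by simp
  qed
  have inc_sym: "inc j p q \<Longrightarrow> inc j q p" for j p q unfolding inc_def by blast
  show False
  proof (cases "\<forall>H :: nat \<Rightarrow> (nat \<Rightarrow> nat) set. Z \<subseteq> (\<Union>k. H k) \<longrightarrow> (\<exists>k. \<exists>x\<in>H k. \<exists>y\<in>H k. K x y)")
    case True
    have "\<exists>S\<subseteq>Z. uncountable S \<and> |S| \<le>o cardSuc natLeq \<and> (\<forall>x\<in>S. \<forall>y\<in>S. x \<noteq> y \<longrightarrow> K x y)"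
    proof (rule PFA_open_coloring[OF pfa])
      show "K y x" if "K x y" for x y using that inc_sym unfolding K_def by blast
      show "\<exists>n. \<forall>w. (\<forall>i<n. w i = x i) \<longrightarrow> K w y" if xy: "K x y" for x y
      proof -
        obtain j where j: "inc j (D x j) (D y j)" using xy unfolding K_def by blast
        have "K w y" if "\<forall>i<Suc j. w i = x i" for w
          using j that unfolding K_def D_def by (intro exI[of _ j]) simp
        then show ?thesis by blast
      qed
      show "\<not> K x x" if "x \<in> Z" for x using that unfolding K_def Z_def by blast
      show "\<exists>k. \<exists>x\<in>H k. \<exists>y\<in>H k. K x y" if "Z \<subseteq> (\<Union>k. H k)" for H :: "nat \<Rightarrow> (nat \<Rightarrow> nat) set"
        using True[THEN spec[of _ H], THEN mp, OF that] .
    qed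
    then obtain S where S: "S \<subseteq> Z" "uncountable S" "|S| \<le>o cardSuc natLeq" "\<forall>x\<in>S. \<forall>y\<in>S. x \<noteq> y \<longrightarrow> K x y"
      by (elim exE conjE)
    have "|(\<lambda>v j. snd (D v j)) ` S| \<le>o cardSuc natLeq" using S(3) card_of_image ordLeq_transitive by blast
    then obtain h where h: "\<forall>f\<in>(\<lambda>v j. snd (D v j)) ` S. \<exists>n0. \<forall>n\<ge>n0. f n \<le> h n"
      using PFA_bounded[OF PFA_hechler[OF pfa]] by blast
    have "\<exists>N. \<forall>j\<ge>N. snd (D v j) \<le> h j \<and> X h \<in> box (fst (D v j))" if v: "v \<in> S" for v
    proof -
      obtain n0 where n0: "\<forall>j\<ge>n0. snd (D v j) \<le> h j"
        using bspec[OF h imageI[OF v]] by (elim exE)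
      have "promise v" using v S(1) unfolding Z_def by blast
      then have "finite {j. X h \<notin> box (fst (D v j))}" by (rule fin_box) (rule X)
      then obtain n1 where n1: "\<forall>j\<in>{j. X h \<notin> box (fst (D v j))}. j < n1"
        unfolding finite_nat_set_iff_bounded by blast
      have "snd (D v j) \<le> h j \<and> X h \<in> box (fst (D v j))" if "j \<ge> max n0 n1" for j
        using n0 n1 that by (meson leD max.boundedE mem_Collect_eq)
      then show ?thesis by blast
    qed
    then obtain N where N: "\<And>v j. v \<in> S \<Longrightarrow> j \<ge> N v \<Longrightarrow> snd (D v j) \<le> h j \<and> X h \<in> box (fst (D v j))" by metis
    \<comment> \<open>From \<open>N v\<close> on, \<open>h\<close> and \<open>X h\<close> control
      the sequence; the finitely many earlier entries are recorded literally. There are countably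
      many codes, so two members of the clique agree in theirs, and no index is left for an edge
      between them.\<close>
    define code where "code v = (N v, map v [0..<N v])" for v
    have "\<not> inj_on code S"
      using countable_image_inj_on[of code S] countableI_type[of "code ` S"] S(2) by blast
    then obtain v w where vw: "v \<in> S" "w \<in> S" "v \<noteq> w" "code v = code w" unfolding inj_on_def by blast
    then have Nw: "N w = N v" and eq: "map w [0..<N v] = map v [0..<N v]" unfolding code_def by auto
    obtain j where j: "inc j (D v j) (D w j)" using S(4)[rule_format, OF vw(1-3)] unfolding K_def by (elim exE)
    show False
    proof (cases "j < N v")
      case True
      then have "w j = v j" using eq by simp
      then have "inc j (D v j) (D v j)" using j by (simp add: D_def)
      then show False using vw(1) S(1) unfolding Z_def by blast
    next
      case False
      then have "snd (D v j) \<le> h j \<and> X h \<in> box (fst (D v j))" "snd (D w j) \<le> h j \<and> X h \<in> box (fst (D w j))"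
        using N vw(1,2) Nw by simp_all
      then show False using j mono X(2)[of h j] unfolding inc_def by blast
    qed
  next
    case False
    then obtain H :: "nat \<Rightarrow> (nat \<Rightarrow> nat) set" where H: "Z \<subseteq> (\<Union>k. H k)" "\<not> (\<exists>k. \<exists>x\<in>H k. \<exists>y\<in>H k. K x y)"
      unfolding not_all not_imp by (elim exE conjE)
    then have free: "\<not> K x y" if "x \<in> H k" "y \<in> H k" for k x y using that by blast
    \<comment> \<open>Boxes are good for the player if some number never accompanies them in
      \<open>H k\<close> at this index: an entry with that number keeps a sequence out of
      \<open>H k\<close>. The pairing reserves infinitely many indices for each \<open>k\<close>,
      one for each bound \<open>c\<close>.\<close>
    define bad where "bad c k ms \<longleftrightarrow> (\<exists>e. \<forall>v\<in>H k. D v (prod_encode (c, k)) \<noteq> (ms, e))" for c k ms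
    \<comment> \<open>Against a strategy defeating the player, every number would occur in
      \<open>H k\<close> with the boxes of either play. The number given by \<open>two_plays\<close>
      then produces two members of \<open>H k\<close> joined by an edge.\<close>
    have win: "wins M b c (bad c k) n []" for c k
    proof (rule ccontr)
      assume "\<not> wins M b c (bad c k) n []"
      then obtain \<phi> where \<phi>: "\<And>ms. length ms < n \<Longrightarrow> finite (\<phi> ms) \<and> \<phi> ms \<subseteq> M (length ms) \<and> card (\<phi> ms) \<le> c"
        and lose: "\<And>ms. length ms = n \<Longrightarrow> (\<forall>i<n. \<phi> (take i ms) \<subseteq> b i (ms ! i)) \<Longrightarrow> \<not> bad c k ms"
        using not_wins_strategy[of M b c "bad c k" n] by blast
      define j where "j = prod_encode (c, k)"
      have "\<exists>ms ms' e. length ms = n \<and> length ms' = n \<and>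
          (\<forall>i<n. \<phi> (take i ms) \<subseteq> b i (ms ! i)) \<and> (\<forall>i<n. \<phi> (take i ms') \<subseteq> b i (ms' ! i)) \<and>
          (\<forall>x. (\<forall>i<n. x i \<in> b i (ms ! i) \<inter> b i (ms' ! i)) \<longrightarrow> x \<in> V j e)"
        by (rule two_plays[where M = M and d = d and c = c]) (assumption | rule metric base mono cov \<phi>)+
      then obtain ms ms' e where len: "length ms = n" "length ms' = n"
        and legal: "\<forall>i<n. \<phi> (take i ms) \<subseteq> b i (ms ! i)" "\<forall>i<n. \<phi> (take i ms') \<subseteq> b i (ms' ! i)"
        and x: "\<forall>x. (\<forall>i<n. x i \<in> b i (ms ! i) \<inter> b i (ms' ! i)) \<longrightarrow> x \<in> V j e"
        by (elim exE conjE)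
      have ms: "\<not> bad c k ms" "\<not> bad c k ms'" using lose[OF len(1) legal(1)] lose[OF len(2) legal(2)] .
      obtain v w where vw: "v \<in> H k" "w \<in> H k" "D v j = (ms, e)" "D w j = (ms', e)"
        using ms unfolding bad_def j_def by blast
      then have "inc j (D v j) (D w j)" unfolding inc_def box_def using x by auto
      then show False using free[OF vw(1,2)] unfolding K_def by blast
    qed
    have "\<exists>B ms. infinite B \<and>
        (\<forall>c\<in>B. \<forall>k\<le>c. length (ms c k) = n \<and> wins M b c (bad c k) (n - length (ms c k)) (ms c k)) \<and>
        (\<forall>i<n. \<forall>x\<in>topspace (?T i). finite {c\<in>B. \<exists>k\<le>c. x \<notin> b i (ms c k ! i)})"
    proof (rule iterated_gamma_selection[OF gamma])
      show "t1_space (?T i)" if "i < n" for i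
        using Metric_space.Hausdorff_space_mtopology[OF metric[OF that]] by (rule Hausdorff_imp_t1_space)
      show "wins M b c (bad c k) (n - length []) []" for c k using win by simp
      show "\<exists>m. F \<subseteq> b (length ms) m \<and> wins M b c (bad c k) (n - length (ms @ [m])) (ms @ [m])"
        if "length ms < n" and wins: "wins M b c (bad c k) (n - length ms) ms"
          and F: "finite F" "F \<subseteq> topspace (?T (length ms))" "card F \<le> c" for c k ms F
      proof -
        have "n - length ms = Suc (n - length (ms @ [m]))" for m using \<open>length ms < n\<close> by simp
        then have "wins M b c (bad c k) (Suc (n - Suc (length ms))) ms" using wins by simp
        then show ?thesis using F unfolding top[OF \<open>length ms < n\<close>] by simp
      qed
    qed (assumption | rule b_open)+
    then obtain B ms where B: "infinite B"
      and won: "\<forall>c\<in>B. \<forall>k\<le>c. length (ms c k) = n \<and> wins M b c (bad c k) (n - length (ms c k)) (ms c k)"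
      and near: "\<forall>i<n. \<forall>x\<in>topspace (?T i). finite {c\<in>B. \<exists>k\<le>c. x \<notin> b i (ms c k ! i)}"
      by (elim exE conjE)
    have ms: "bad c k (ms c k)" if "c \<in> B" "k \<le> c" for c k
    proof -
      have "length (ms c k) = n" "wins M b c (bad c k) (n - length (ms c k)) (ms c k)"
        using won that by blast+
      then show ?thesis by simp
    qed
    have fin: "finite {c\<in>B. \<exists>k\<le>c. x \<notin> b i (ms c k ! i)}" if "i < n" "x \<in> M i" for i x
      using near that top by blast
    have "\<exists>e. c \<in> B \<longrightarrow> k \<le> c \<longrightarrow> (\<forall>v\<in>H k. D v (prod_encode (c, k)) \<noteq> (ms c k, e))" for c k
      using ms[of c k] unfolding bad_def by blast
    then obtain E where E: "\<And>c k v. c \<in> B \<Longrightarrow> k \<le> c \<Longrightarrow> v \<in> H k \<Longrightarrow> D v (prod_encode (c, k)) \<noteq> (ms c k, E c k)"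
      by metis
    \<comment> \<open>Indices outside the selection carry the whole space, so they cannot spoil the
      promise.\<close>
    define v where "v j = (case prod_decode j of (c, k) \<Rightarrow>
        to_nat (if c \<in> B \<and> k \<le> c then (ms c k, E c k) else (replicate n 0, 0 :: nat)))" for j
    define h where "h j = snd (D v j)" for j
    have "finite {j. x \<notin> b i (fst (D v j) ! i)}" if i: "i < n" "x \<in> M i" for i x
    proof (rule finite_subset)
      let ?A = "{c\<in>B. \<exists>k\<le>c. x \<notin> b i (ms c k ! i)}"
      show "finite (prod_encode ` (SIGMA c:?A. {..c}))" using fin[OF i] by (intro finite_imageI finite_SigmaI) simp_all
      show "{j. x \<notin> b i (fst (D v j) ! i)} \<subseteq> prod_encode ` (SIGMA c:?A. {..c})"
      proof
        fix j assume j: "j \<in> {j. x \<notin> b i (fst (D v j) ! i)}"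
        obtain c k where ck: "prod_decode j = (c, k)" by fastforce
        then have "j = prod_encode (c, k)" by (metis prod_decode_inverse)
        moreover have "D v j = (if c \<in> B \<and> k \<le> c then (ms c k, E c k) else (replicate n 0, 0))"
          by (simp add: D_def v_def ck)
        then have "c \<in> B \<and> k \<le> c" "x \<notin> b i (ms c k ! i)"
          using j i b0[OF i(1)] by (auto split: if_splits)
        ultimately show "j \<in> prod_encode ` (SIGMA c:?A. {..c})" by auto
      qed
    qed
    then have v: "promise v" unfolding promise_def by blast
    \<comment> \<open>The sequence \<open>v\<close> need not lie in \<open>Z\<close>. The point
      missed by its own numbers \<open>h\<close> escapes only finitely many of its boxes; replacing
      these entries by the whole space with number 0 makes \<open>X h\<close> a witness at every
      index that the box is not covered.\<close>
    define J where "J = {j. X h \<notin> box (fst (D v j))}"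
    have J: "finite J" unfolding J_def using v by (rule fin_box) (rule X)
    define v' where "v' j = (if j \<in> J then to_nat (replicate n (0 :: nat), 0 :: nat) else v j)" for j
    have D1: "D v' j = (replicate n 0, 0)" if "j \<in> J" for j using that by (simp add: D_def v'_def)
    have D2: "D v' j = D v j" if "j \<notin> J" for j using that by (simp add: D_def v'_def)
    have "promise v'"
      unfolding promise_def
    proof (intro allI impI ballI)
      fix i x assume i: "i < n" "x \<in> M i"
      have "{j. x \<notin> b i (fst (D v' j) ! i)} \<subseteq> {j. x \<notin> b i (fst (D v j) ! i)}"
      proof
        fix j assume j: "j \<in> {j. x \<notin> b i (fst (D v' j) ! i)}"
        then have "j \<notin> J" using D1[of j] i b0[OF i(1)] by auto
        then show "j \<in> {j. x \<notin> b i (fst (D v j) ! i)}" using j D2 by simp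
      qed
      then show "finite {j. x \<notin> b i (fst (D v' j) ! i)}"
        using v i unfolding promise_def by (meson finite_subset)
    qed
    moreover have "\<not> inc j (D v' j) (D v' j)" for j
    proof -
      have "X h \<in> box (fst (D v' j)) \<and> snd (D v' j) \<le> h j"
      proof (cases "j \<in> J")
        case True
        then show ?thesis using D1[OF True] X(1) b0 unfolding box_def by simp
      next
        case False
        then show ?thesis using D2[OF False] unfolding J_def h_def by simp
      qed
      then show ?thesis using mono X(2)[of h j] unfolding inc_def by blast
    qed
    ultimately have "v' \<in> Z" unfolding Z_def by simp
    then obtain k where k: "v' \<in> H k" using H(1) by blast
    \<comment> \<open>Infinitely many indices serve \<open>H k\<close> and only finitely many
      entries were changed, so an entry chosen to avoid \<open>H k\<close> survives.\<close>
    have "finite ((\<lambda>c. prod_encode (c, k)) -` J)" using J by (intro finite_vimageI) (auto simp: inj_def)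
    then have "finite ((\<lambda>c. prod_encode (c, k)) -` J \<union> {..<k})" by simp
    then have "\<not> B \<subseteq> (\<lambda>c. prod_encode (c, k)) -` J \<union> {..<k}" using B by (meson finite_subset)
    then obtain c where c: "c \<in> B" "c \<notin> (\<lambda>c. prod_encode (c, k)) -` J \<union> {..<k}" by (meson subsetI)
    then have "k \<le> c" "prod_encode (c, k) \<notin> J" by auto
    then have "D v' (prod_encode (c, k)) = (ms c k, E c k)"
      using D2 c(1) by (simp add: D_def v_def)
    then show False using E[OF c(1) \<open>k \<le> c\<close> k] by simp
  qed
qed

section \<open>Countable subcovers and the reduction to finite powers\<close>

lemma second_countable_separable_metric:
  assumes "Metric_space M d" "separable_space (Metric_space.mtopology M d)"
  shows "second_countable (Metric_space.mtopology M d)"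
proof -
  interpret Metric_space M d by fact
  obtain b :: "nat \<Rightarrow> 'a set" where b: "\<forall>m. openin mtopology (b m)"
      "\<forall>F r. finite F \<longrightarrow> F \<subseteq> M \<longrightarrow> r > 0 \<longrightarrow> (\<exists>m. F \<subseteq> b m \<and> (\<forall>x\<in>b m. x \<in> M \<and> (\<exists>y\<in>F. d y x < r)))"
    using separable_metric_base[OF assms] by (elim exE conjE)
  have "\<exists>V\<in>range b. x \<in> V \<and> V \<subseteq> U" if U: "openin mtopology U" "x \<in> U" for U x
  proof -
    obtain r where r: "r > 0" "mball x r \<subseteq> U" "x \<in> M"
      using U unfolding openin_mtopology by blast
    then obtain m where m: "{x} \<subseteq> b m" "\<forall>z\<in>b m. z \<in> M \<and> (\<exists>y\<in>{x}. d y z < r)"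
      using b(2)[rule_format, of "{x}" r] by auto
    then have "b m \<subseteq> mball x r" using r(3) by auto
    then show ?thesis using m(1) r(2) by (intro bexI[of _ "b m"]) auto
  qed
  then show ?thesis unfolding second_countable_def using b(1) by (intro exI[of _ "range b"]) simp
qed

lemma second_countable_finite_product:
  assumes fin: "finite I" and sc: "\<And>i. i \<in> I \<Longrightarrow> second_countable (X i)"
  shows "second_countable (product_topology X I)"
proof -
  have "\<exists>\<B>. i \<in> I \<longrightarrow> countable \<B> \<and> (\<forall>V\<in>\<B>. openin (X i) V) \<and>
      (\<forall>U x. openin (X i) U \<and> x \<in> U \<longrightarrow> (\<exists>V\<in>\<B>. x \<in> V \<and> V \<subseteq> U))" for i
    using sc[of i] unfolding second_countable_def by blast
  then obtain \<B> where \<B>: "\<And>i. i \<in> I \<Longrightarrow> countable (\<B> i)" "\<And>i V. i \<in> I \<Longrightarrow> V \<in> \<B> i \<Longrightarrow> openin (X i) V"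
    "\<And>i U x. i \<in> I \<Longrightarrow> openin (X i) U \<Longrightarrow> x \<in> U \<Longrightarrow> \<exists>V\<in>\<B> i. x \<in> V \<and> V \<subseteq> U" by metis
  define \<C> where "\<C> = PiE I ` PiE I \<B>"
  have "countable \<C>" unfolding \<C>_def by (intro countable_image countable_PiE fin \<B>(1))
  moreover have "\<forall>V\<in>\<C>. openin (product_topology X I) V"
    unfolding \<C>_def using fin \<B>(2) by (auto simp: openin_PiE_gen PiE_mem)
  moreover have "\<exists>V\<in>\<C>. x \<in> V \<and> V \<subseteq> U" if U: "openin (product_topology X I) U" "x \<in> U" for U x
  proof -
    obtain W where W: "\<forall>i\<in>I. openin (X i) (W i)" "x \<in> PiE I W" "PiE I W \<subseteq> U"
      using U unfolding openin_product_topology_alt by blast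
    have "\<exists>V. i \<in> I \<longrightarrow> V \<in> \<B> i \<and> x i \<in> V \<and> V \<subseteq> W i" for i
    proof (cases "i \<in> I")
      case True
      then show ?thesis using \<B>(3)[OF True bspec[OF W(1) True] PiE_mem[OF W(2) True]] by auto
    qed simp
    then obtain V where V: "\<And>i. i \<in> I \<Longrightarrow> V i \<in> \<B> i \<and> x i \<in> V i \<and> V i \<subseteq> W i" by metis
    show ?thesis
    proof (intro bexI conjI)
      show "PiE I (restrict V I) \<in> \<C>" unfolding \<C>_def using V by auto
      show "x \<in> PiE I (restrict V I)" using V W(2) by (auto simp: PiE_iff)
      have "PiE I (restrict V I) \<subseteq> PiE I W" using V by (intro PiE_mono) simp
      then show "PiE I (restrict V I) \<subseteq> U" using W(3) by blast
    qed
  qed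
  ultimately show ?thesis unfolding second_countable_def by (intro exI[of _ \<C>]) simp
qed

text \<open>For each finite union of basic sets that fits into some member, one such member is kept.
  A finite set inside a member is already inside a finite union of basic sets contained in that
  member.\<close>

lemma Omega_covers_countable:
  assumes sc: "second_countable X" and \<U>: "\<U> \<in> Omega_covers X"
  shows "\<exists>U :: nat \<Rightarrow> 'a set. (\<forall>m. U m \<in> \<U>) \<and> (\<forall>F. finite F \<longrightarrow> F \<subseteq> topspace X \<longrightarrow> (\<exists>m. F \<subseteq> U m))"
proof -
  obtain \<B> where \<B>: "countable \<B>" "\<forall>U x. openin X U \<and> x \<in> U \<longrightarrow> (\<exists>V\<in>\<B>. x \<in> V \<and> V \<subseteq> U)"
    using sc unfolding second_countable_def by (elim exE conjE)
  have cov: "\<exists>U\<in>\<U>. F \<subseteq> U" if "finite F" "F \<subseteq> topspace X" for F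
    using \<U> that unfolding Omega_covers_def by blast
  have op: "openin X U" if "U \<in> \<U>" for U
    using \<U> that unfolding Omega_covers_def open_cover_of_def by blast
  define \<W> where "\<W> = {\<G>. finite \<G> \<and> \<G> \<subseteq> \<B>}"
  have "countable \<W>" unfolding \<W>_def by (rule countable_Collect_finite_subset[OF \<B>(1)])
  then have surj: "\<exists>m. from_nat_into \<W> m = \<G>" if "\<G> \<in> \<W>" for \<G>
    using that by (rule from_nat_into_surj)
  have "\<exists>U. U \<in> \<U> \<and> ((\<exists>U'\<in>\<U>. \<Union>(from_nat_into \<W> m) \<subseteq> U') \<longrightarrow> \<Union>(from_nat_into \<W> m) \<subseteq> U)" for m
    using cov[of "{}"] by blast
  then obtain U where U: "\<And>m. U m \<in> \<U>"
    "\<And>m U'. U' \<in> \<U> \<Longrightarrow> \<Union>(from_nat_into \<W> m) \<subseteq> U' \<Longrightarrow> \<Union>(from_nat_into \<W> m) \<subseteq> U m" by metis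
  have "\<exists>m. F \<subseteq> U m" if F: "finite F" "F \<subseteq> topspace X" for F
  proof -
    obtain U' where U': "U' \<in> \<U>" "F \<subseteq> U'" using cov[OF F] by blast
    have "\<exists>V. x \<in> F \<longrightarrow> V \<in> \<B> \<and> x \<in> V \<and> V \<subseteq> U'" for x
      using \<B>(2)[rule_format, of U' x] op[OF U'(1)] U'(2) by auto
    then obtain V where V: "\<And>x. x \<in> F \<Longrightarrow> V x \<in> \<B> \<and> x \<in> V x \<and> V x \<subseteq> U'" by metis
    have "V ` F \<in> \<W>" unfolding \<W>_def using F(1) V by auto
    then obtain m where m: "from_nat_into \<W> m = V ` F" using surj by blast
    have "F \<subseteq> \<Union>(V ` F)" "\<Union>(V ` F) \<subseteq> U'" using V by blast+
    then show ?thesis using U(2)[OF U'(1), of m] unfolding m by blast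
  qed
  then show ?thesis using U(1) by blast
qed

lemma product_topology_metric_ball:
  assumes fin: "finite I" and metric: "\<And>i. i \<in> I \<Longrightarrow> Metric_space (M i) (d i)"
    and U: "openin (product_topology (\<lambda>i. Metric_space.mtopology (M i) (d i)) I) U" "y \<in> U"
  shows "\<exists>r>0. \<forall>z\<in>PiE I M. (\<forall>i\<in>I. d i (y i) (z i) < r) \<longrightarrow> z \<in> U"
proof -
  obtain W where W: "\<forall>i\<in>I. openin (Metric_space.mtopology (M i) (d i)) (W i)" "y \<in> PiE I W" "PiE I W \<subseteq> U"
    using U unfolding openin_product_topology_alt by blast
  have "\<exists>r. i \<in> I \<longrightarrow> r > 0 \<and> (\<forall>z\<in>M i. d i (y i) z < r \<longrightarrow> z \<in> W i)" for i
  proof (cases "i \<in> I")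
    case True
    interpret Metric_space "M i" "d i" by (rule metric[OF True])
    have y: "openin mtopology (W i)" "y i \<in> W i" using W True by (simp, blast)
    then obtain r where "r > 0" "mball (y i) r \<subseteq> W i" "y i \<in> M i" unfolding openin_mtopology by blast
    then show ?thesis by (intro exI[of _ r]) auto
  qed simp
  then obtain r where r: "\<And>i. i \<in> I \<Longrightarrow> r i > 0 \<and> (\<forall>z\<in>M i. d i (y i) z < r i \<longrightarrow> z \<in> W i)" by metis
  define r' where "r' = Min (insert 1 (r ` I))"
  have r': "r' > 0" "\<And>i. i \<in> I \<Longrightarrow> r' \<le> r i" unfolding r'_def using r fin by auto
  have "z \<in> U" if z: "z \<in> PiE I M" "\<forall>i\<in>I. d i (y i) (z i) < r'" for z
  proof -
    have "z i \<in> W i" if i: "i \<in> I" for i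
    proof -
      have "d i (y i) (z i) < r i" using z(2) r'(2)[OF i] i by force
      then show ?thesis using r[OF i] PiE_mem[OF z(1) i] by blast
    qed
    then have "z \<in> PiE I W" using z(1) by (auto simp: PiE_iff)
    then show ?thesis using W(3) by blast
  qed
  then show ?thesis using r'(1) by blast
qed

text \<open>The power is a product of \<open>k * N\<close> factors: coordinate \<open>p\<close> is
  factor \<open>p mod N\<close> of the point with number \<open>p div N\<close>. A tuple belongs to
  \<open>V j b\<close> if one of the first \<open>b\<close> sets contains all its points at once,
  which turns \<omega>-covers of the product into covers of the power.\<close>

lemma PFA_menger_finite_powers:
  fixes I :: "'i set" and M :: "'i \<Rightarrow> 'a set" and d :: "'i \<Rightarrow> 'a \<Rightarrow> 'a \<Rightarrow> real" and k :: nat and U :: "nat \<Rightarrow> nat \<Rightarrow> ('i \<Rightarrow> 'a) set"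
  assumes pfa: "PFA TYPE(real set set set set)"
    and fin: "finite I"
    and metric: "\<And>i. i \<in> I \<Longrightarrow> Metric_space (M i) (d i)"
    and separable: "\<And>i. i \<in> I \<Longrightarrow> separable_space (Metric_space.mtopology (M i) (d i))"
    and gamma: "\<And>i. i \<in> I \<Longrightarrow> gamma_space (Metric_space.mtopology (M i) (d i))"
    and op: "\<And>j m. openin (product_topology (\<lambda>i. Metric_space.mtopology (M i) (d i)) I) (U j m)"
    and cov: "\<And>j F. finite F \<Longrightarrow> F \<subseteq> PiE I M \<Longrightarrow> \<exists>m. F \<subseteq> U j m"
  shows "\<exists>h. \<forall>y. (\<forall>l<k. y l \<in> PiE I M) \<longrightarrow> (\<exists>j m. m < h j \<and> (\<forall>l<k. y l \<in> U j m))"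
proof -
  define N where "N = card I"
  obtain \<iota> where \<iota>: "bij_betw \<iota> {..<N} I"
    using ex_bij_betw_nat_finite[OF fin] unfolding N_def lessThan_atLeast0 by blast
  define e where "e = inv_into {..<N} \<iota>"
  have e: "e i < N" "\<iota> (e i) = i" if "i \<in> I" for i
    using that \<iota> bij_betw_inv_into_right[OF \<iota>] bij_betwE[OF bij_betw_inv_into[OF \<iota>]] unfolding e_def by auto
  have I: "\<iota> (p mod N) \<in> I" if "p < k * N" for p
  proof -
    have "p mod N < N" using that by (cases "N = 0") auto
    then show ?thesis using bij_betwE[OF \<iota>] by simp
  qed
  define co where "co l i = l * N + e i" for l i
  have co: "co l i < k * N" "co l i mod N = e i" "co l i div N = l" if "l < k" "i \<in> I" for l i
  proof -
    have "l * N + e i < Suc l * N" using e(1)[OF that(2)] by simp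
    also have "\<dots> \<le> k * N" using that(1) by (intro mult_le_mono1) simp
    finally show "co l i < k * N" by (simp add: co_def)
    show "co l i mod N = e i" "co l i div N = l" using e(1)[OF that(2)] by (simp_all add: co_def)
  qed
  define pt where "pt x l = (\<lambda>i\<in>I. x (co l i))" for x :: "nat \<Rightarrow> 'a" and l
  have pt: "pt x l \<in> PiE I M" if "\<forall>p<k * N. x p \<in> M (\<iota> (p mod N))" "l < k" for x l
    unfolding pt_def restrict_PiE_iff
  proof
    fix i assume i: "i \<in> I"
    show "x (co l i) \<in> M i"
      using that(1)[rule_format, OF co(1)[OF that(2) i]] co(2)[OF that(2) i] e(2)[OF i] by simp
  qed
  define V where "V j b = {x. \<exists>m<b. \<forall>l<k. pt x l \<in> U j m}" for j b
  have "\<exists>h. \<forall>x. (\<forall>p<k * N. x p \<in> M (\<iota> (p mod N))) \<longrightarrow> (\<exists>j. x \<in> V j (h j))"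
  proof (rule PFA_product_menger[OF pfa, where d = "\<lambda>p. d (\<iota> (p mod N))"])
    show "V j b \<subseteq> V j b'" if "b \<le> b'" for j b b'
      unfolding V_def using that less_le_trans by blast
    show "\<exists>b. \<exists>r>0. \<forall>y. (\<forall>p<k * N. y p \<in> M (\<iota> (p mod N)) \<and> d (\<iota> (p mod N)) (x p) (y p) < r) \<longrightarrow> y \<in> V j b"
      if x: "\<forall>p<k * N. x p \<in> M (\<iota> (p mod N))" for j x
    proof -
      obtain m where m: "pt x ` {..<k} \<subseteq> U j m"
        using cov[of "pt x ` {..<k}" j] pt[OF x] by auto
      have "\<exists>r. l < k \<longrightarrow> r > 0 \<and> (\<forall>z\<in>PiE I M. (\<forall>i\<in>I. d i (pt x l i) (z i) < r) \<longrightarrow> z \<in> U j m)" for l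
        using product_topology_metric_ball[OF fin metric op, of "pt x l" j m] m by blast
      then obtain r where r: "\<And>l. l < k \<Longrightarrow> r l > 0 \<and> (\<forall>z\<in>PiE I M. (\<forall>i\<in>I. d i (pt x l i) (z i) < r l) \<longrightarrow> z \<in> U j m)"
        by metis
      define r' where "r' = Min (insert 1 (r ` {..<k}))"
      have r': "r' > 0" "\<And>l. l < k \<Longrightarrow> r' \<le> r l" unfolding r'_def using r by auto
      have "y \<in> V j (Suc m)"
        if y: "\<forall>p<k * N. y p \<in> M (\<iota> (p mod N)) \<and> d (\<iota> (p mod N)) (x p) (y p) < r'" for y
      proof -
        have "pt y l \<in> U j m" if l: "l < k" for l
        proof -
          have "d i (pt x l i) (pt y l i) < r l" if i: "i \<in> I" for i
            using y[rule_format, OF co(1)[OF l i]] r'(2)[OF l] i unfolding pt_def co(2)[OF l i] e(2)[OF i] by simp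
          moreover have "pt y l \<in> PiE I M" using pt[of y l] y l by blast
          ultimately show ?thesis using r[OF l] by blast
        qed
        then show ?thesis unfolding V_def by blast
      qed
      then show ?thesis using r'(1) by blast
    qed
  qed (use I metric separable gamma in blast)+
  then obtain h where h: "\<And>x. (\<forall>p<k * N. x p \<in> M (\<iota> (p mod N))) \<Longrightarrow> \<exists>j. x \<in> V j (h j)" by blast
  have "\<exists>j m. m < h j \<and> (\<forall>l<k. y l \<in> U j m)" if y: "\<forall>l<k. y l \<in> PiE I M" for y
  proof -
    define x where "x p = y (p div N) (\<iota> (p mod N))" for p
    have "x p \<in> M (\<iota> (p mod N))" if p: "p < k * N" for p
    proof -
      have "p div N < k" using p by (simp add: less_mult_imp_div_less)
      then show ?thesis unfolding x_def using y I[OF p] by (auto intro: PiE_mem)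
    qed
    then obtain j where "x \<in> V j (h j)" using h by blast
    moreover have "pt x l = y l" if l: "l < k" for l
    proof
      fix i show "pt x l i = y l i"
        using y l co(2,3)[OF l, of i] e(2)[of i] PiE_arb[of "y l" I M i] unfolding pt_def x_def by (cases "i \<in> I") auto
    qed
    ultimately show ?thesis unfolding V_def by auto
  qed
  then show ?thesis by blast
qed

theorem theorem6p3:
  fixes I :: "'i set" and M :: "'i \<Rightarrow> 'a set" and d :: "'i \<Rightarrow> 'a \<Rightarrow> 'a \<Rightarrow> real"
  assumes pfa: "PFA TYPE(real set set set set)"
    and fin: "finite I"
    and metric: "\<And>i. i \<in> I \<Longrightarrow> Metric_space (M i) (d i)"
    and separable: "\<And>i. i \<in> I \<Longrightarrow> separable_space (Metric_space.mtopology (M i) (d i))"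
    and gamma: "\<And>i. i \<in> I \<Longrightarrow> gamma_space (Metric_space.mtopology (M i) (d i))"
  shows "S_fin_Omega_Omega (product_topology (\<lambda>i. Metric_space.mtopology (M i) (d i)) I)"
proof -
  define X where "X = product_topology (\<lambda>i. Metric_space.mtopology (M i) (d i)) I"
  have top: "topspace X = PiE I M"
    unfolding X_def topspace_product_topology
    by (rule PiE_cong) (simp add: Metric_space.topspace_mtopology metric)
  have sc: "second_countable X"
    unfolding X_def using metric separable
    by (intro second_countable_finite_product fin second_countable_separable_metric) simp_all
  have "\<exists>\<F>. (\<forall>n. finite (\<F> n) \<and> \<F> n \<subseteq> \<U> n) \<and> (\<Union>n. \<F> n) \<in> Omega_covers X"
    if \<U>: "\<And>n. \<U> n \<in> Omega_covers X" for \<U> :: "nat \<Rightarrow> ('i \<Rightarrow> 'a) set set"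
  proof -
    have "\<exists>U :: nat \<Rightarrow> _. (\<forall>m. U m \<in> \<U> j) \<and> (\<forall>F. finite F \<longrightarrow> F \<subseteq> topspace X \<longrightarrow> (\<exists>m. F \<subseteq> U m))" for j
      by (rule Omega_covers_countable[OF sc \<U>])
    then obtain U :: "nat \<Rightarrow> nat \<Rightarrow> _" where U: "\<And>j m. U j m \<in> \<U> j"
      and cov: "\<And>j F. finite F \<Longrightarrow> F \<subseteq> PiE I M \<Longrightarrow> \<exists>m. F \<subseteq> U j m"
      unfolding top by metis
    have op: "openin X (U j m)" and proper: "\<not> topspace X \<subseteq> U j m" for j m
      using \<U>[of j] U[of j m] unfolding Omega_covers_def open_cover_of_def cover_of_def by auto
    \<comment> \<open>For the power \<open>k\<close> only the covers from index \<open>k\<close> on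
      are used. At a given index just finitely many powers make a demand, so the union of their
      selections stays finite.\<close>
    have "\<exists>h. \<forall>y. (\<forall>l<k. y l \<in> PiE I M) \<longrightarrow> (\<exists>j m. m < h j \<and> (\<forall>l<k. y l \<in> U (j + k) m))" for k
      by (rule PFA_menger_finite_powers[OF pfa fin metric separable gamma])
        (simp_all add: op[unfolded X_def] cov)
    then obtain h where h: "\<And>k y. (\<forall>l<k. y l \<in> PiE I M) \<Longrightarrow> \<exists>j m. m < h k j \<and> (\<forall>l<k. y l \<in> U (j + k) m)"
      by metis
    define \<F> where "\<F> j = (\<Union>k\<le>j. U j ` {..<h k (j - k)})" for j
    have \<omega>: "\<exists>W\<in>(\<Union>n. \<F> n). F \<subseteq> W" if F: "finite F" "F \<subseteq> topspace X" for F
    proof -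
      obtain y where y: "y ` {..<card F} = F"
        using ex_bij_betw_nat_finite[OF F(1)] unfolding bij_betw_def lessThan_atLeast0 by blast
      then have "\<forall>l<card F. y l \<in> PiE I M" using F(2) unfolding top by blast
      then obtain j m where jm: "m < h (card F) j" "\<forall>l<card F. y l \<in> U (j + card F) m"
        using h by blast
      have "U (j + card F) m \<in> \<F> (j + card F)"
        unfolding \<F>_def using jm(1) by (intro UN_I[of "card F"]) auto
      moreover have "y ` {..<card F} \<subseteq> U (j + card F) m" using jm(2) by auto
      then have "F \<subseteq> U (j + card F) m" unfolding y .
      ultimately show ?thesis by blast
    qed
    have sub: "W \<in> range (case_prod U)" if "W \<in> (\<Union>n. \<F> n)" for W
      using that unfolding \<F>_def by auto
    have "\<Union>(\<Union>n. \<F> n) = topspace X"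
    proof
      show "\<Union>(\<Union>n. \<F> n) \<subseteq> topspace X" using openin_subset[OF op] unfolding \<F>_def by blast
      show "topspace X \<subseteq> \<Union>(\<Union>n. \<F> n)"
      proof
        fix x assume "x \<in> topspace X"
        then show "x \<in> \<Union>(\<Union>n. \<F> n)" using \<omega>[of "{x}"] by auto
      qed
    qed
    moreover have "\<forall>W\<in>(\<Union>n. \<F> n). openin X W \<and> \<not> topspace X \<subseteq> W"
      using op proper unfolding \<F>_def by blast
    ultimately have "(\<Union>n. \<F> n) \<in> Omega_covers X"
      unfolding Omega_covers_def open_cover_of_def cover_of_def using \<omega> by simp
    moreover have "finite (\<F> n) \<and> \<F> n \<subseteq> \<U> n" for n
      using U unfolding \<F>_def by auto
    ultimately show ?thesis by blast
  qed
  then show ?thesis unfolding S_fin_Omega_Omega_def X_def[symmetric] by blast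
qed

end
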